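(* Let $d\in\{2,3\}$, $\nu>0$, and let $\omega_0\in L^\infty(\mathbb R^d)$ satisfy, for some constants $\kappa,\sigma>0$, $$|\omega_0(x)|\le \kappa\,G_{\nu\sigma}(x)\quad\text{for a.e. }x\in\mathbb R^d .$$ Let $\omega$ be the strong solution to the vorticity equation generated by $\omega_0$, with maximal lifespan $0<T_{max}\le\infty$, and let $u$ be the associated velocity. Then for every $0<\delta\le 1$ there is a constant $C_\delta>0$ depending only on $\delta$ such that for all $(x,t)\in\mathbb R^d\times[0,T_{max})$, $$|\omega(x,t)|\le A\,\kappa\left(C_\delta\frac{t\,\|u\|_{\infty,t}^2}{\nu}\right)^{C_\delta\frac{t\|u\|_{\infty,t}^2}{\nu}}G_{(1+\delta)\nu(\sigma+t)}(x),$$ where $\|u\|_{\infty,t}:=\|u\|_{L^\infty((0,t)\times\mathbb R^d)}$ and $A>0$ is a universal constant.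
   Context: $G_t(x)=(4\pi t)^{-d/2}e^{-|x|^2/(4t)}$ for $(x,t)\in\mathbb R^d\times(0,\infty)$. The vorticity form of the incompressible Navier–Stokes equations on $\mathbb R^d$ with viscosity $\nu>0$ is, for $\omega=\mathrm{curl}\,u$: $\partial_t\omega+u\cdot\nabla\omega-\nu\Delta\omega=0$ if $d=2$ ($\omega$ scalar), and $\partial_t\omega+u\cdot\nabla\omega-\nu\Delta\omega=\omega\cdot\nabla u$ if $d=3$. The velocity $u$ is recovered from $\omega$ by the Biot–Savart law: $u(x)=\frac1{2\pi}\int_{\mathbb R^2}\frac{(x-y)^\perp}{|x-y|^2}\omega(y)\,dy$ with $(a,b)^\perp=(-b,a)$ if $d=2$, and $u(x)=-\frac1{4\pi}\int_{\mathbb R^3}\frac{(x-y)\times\omega(y)}{|x-y|^3}\,dy$ if $d=3$. For $d/2\le p\le\infty$, $\omega\in C([0,T);L^p)$ is a strong (mild) solution arising from $\omega_0\in L^p$ if $$\omega(x,t)=G_{\nu t}*\omega_0(x)+\int_0^tG_{\nu(t-s)}*\mathrm{div}\big(-u(s)\otimes\omega(s)+\omega(s)\otimes u(s)\big)(x)\,ds$$ holds in $C([0,T);L^p)$ and for a.e. $(x,t)\in\mathbb R^d\times[0,T)$. Here $\mathrm{div}(a\otimes b)=\sum_\ell\partial_\ell(a^\ell b)$; for $d=2$ the stretching term $\omega\otimes u$ is absent (equal to zero). The maximal lifespan is $T_{max}:=\sup\{T>0:\ \text{there exists a unique solution }\omega\in C([0,T];L^{d+1})\text{ with }\omega(0)=\omega_0\}$.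 Convention: $0^0=1$. *)

theory Defs
  imports "HOL-Analysis.Analysis" "HOL-Probability.Essential_Supremum"
begin

section \<open>Lebesgue spaces\<close>

text \<open>
  Elements of \<open>L\<^sup>p\<close> are given by Borel measurable representatives; every Lebesgue class has one,
  and statements about classes are made up to null sets.
\<close>

definition Lp_norm :: "ennreal \<Rightarrow> 'b measure \<Rightarrow> ('b \<Rightarrow> 'v::real_normed_vector) \<Rightarrow> ennreal" where
  "Lp_norm p M f =
    (if p = \<infinity> then esssup M (\<lambda>x. ennreal (norm (f x)))
     else let J = (\<integral>\<^sup>+x. ennreal (norm (f x) powr enn2real p) \<partial>M)
          in if J = \<infinity> then \<infinity> else ennreal (enn2real J powr (1 / enn2real p)))"

definition Lp_space :: "ennreal \<Rightarrow> 'b measure \<Rightarrow> ('b \<Rightarrow> 'v::real_normed_vector) set" where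
  "Lp_space p M = {f \<in> borel_measurable M. Lp_norm p M f < \<infinity>}"

definition continuous_in_Lp ::
  "ennreal \<Rightarrow> real set \<Rightarrow> (real \<Rightarrow> 'a::euclidean_space \<Rightarrow> 'v::real_normed_vector) \<Rightarrow> bool" where
  "continuous_in_Lp p I w \<longleftrightarrow>
    (\<forall>t\<in>I. w t \<in> Lp_space p lborel \<and>
      ((\<lambda>s. Lp_norm p lborel (\<lambda>x. w s x - w t x)) \<longlongrightarrow> 0) (at t within I))"

text \<open>The norm of \<open>L\<^sup>\<infinity>((0,t) \<times> \<real>\<^sup>d)\<close>; it is \<open>0\<close> for \<open>t = 0\<close> and may be \<open>\<infinity>\<close>.\<close>

definition sup_norm_upto ::
  "real \<Rightarrow> (real \<Rightarrow> 'a::euclidean_space \<Rightarrow> 'v::real_normed_vector) \<Rightarrow> ennreal" where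
  "sup_norm_upto t u =
    Lp_norm \<infinity> (restrict_space lborel ({0<..<t} \<times> UNIV)) (\<lambda>(s, x). u s x)"


section \<open>Heat kernel\<close>

definition heat_kernel :: "real \<Rightarrow> 'a::euclidean_space \<Rightarrow> real" where
  "heat_kernel t x = (4 * pi * t) powr (- real DIM('a) / 2) * exp (- ((norm x)\<^sup>2) / (4 * t))"

definition heat_conv :: "real \<Rightarrow> ('a::euclidean_space \<Rightarrow> 'v::euclidean_space) \<Rightarrow> 'a \<Rightarrow> 'v" where
  "heat_conv \<tau> f x = (\<integral>y. heat_kernel \<tau> (x - y) *\<^sub>R f y \<partial>lborel)"

text \<open>
  For a field \<open>F\<close> with components \<open>F\<^sup>l\<close> (written \<open>F y l\<close>, \<open>l\<close> a basis vector),
  \<open>div F = (\<Sum>l. \<partial>\<^sub>l F\<^sup>l)\<close> is a distribution, and its convolution with the heat kernel is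
  \<open>\<integral> (\<Sum>l. (\<partial>\<^sub>l G\<^sub>\<tau>)(x - y) F\<^sup>l(y)) dy\<close>.
\<close>

definition heat_div_integrand ::
  "real \<Rightarrow> ('a::euclidean_space \<Rightarrow> 'a \<Rightarrow> 'v::euclidean_space) \<Rightarrow> 'a \<Rightarrow> 'a \<Rightarrow> 'v" where
  "heat_div_integrand \<tau> F x y =
    (\<Sum>l\<in>Basis. frechet_derivative (heat_kernel \<tau>) (at (x - y)) l *\<^sub>R F y l)"

definition heat_conv_div ::
  "real \<Rightarrow> ('a::euclidean_space \<Rightarrow> 'a \<Rightarrow> 'v::euclidean_space) \<Rightarrow> 'a \<Rightarrow> 'v" where
  "heat_conv_div \<tau> F x = (\<integral>y. heat_div_integrand \<tau> F x y \<partial>lborel)"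


section \<open>Mild solutions of the vorticity equation\<close>

text \<open>
  The planar and the spatial equation differ in the Biot--Savart kernel \<open>K z w\<close> (which is linear in
  the vorticity value \<open>w\<close>) and in the components \<open>\<Phi> u w l\<close> of the flux \<open>- u \<otimes> \<omega> + \<omega> \<otimes> u\<close>, where
  \<open>(a \<otimes> b)\<^sup>l = a\<^sup>l b\<close>.  Both are parameters below.
\<close>

definition velocity ::
  "('a::euclidean_space \<Rightarrow> 'v::euclidean_space \<Rightarrow> 'a) \<Rightarrow> ('a \<Rightarrow> 'v) \<Rightarrow> 'a \<Rightarrow> 'a" where
  "velocity K w x = (\<integral>y. K (x - y) (w y) \<partial>lborel)"

text \<open>
  The integral equation at a point \<open>(x, t)\<close> with \<open>t > 0\<close>.  Since the Bochner integral of a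
  non-integrable function is \<open>0\<close>, convergence of the integrals is demanded explicitly.
\<close>

definition mild_equation_at ::
  "('a::euclidean_space \<Rightarrow> 'v::euclidean_space \<Rightarrow> 'a) \<Rightarrow> ('a \<Rightarrow> 'v \<Rightarrow> 'a \<Rightarrow> 'v) \<Rightarrow> real \<Rightarrow>
    ('a \<Rightarrow> 'v) \<Rightarrow> (real \<Rightarrow> 'a \<Rightarrow> 'v) \<Rightarrow> real \<Rightarrow> 'a \<Rightarrow> bool" where
  "mild_equation_at K \<Phi> \<nu> w0 w t x \<longleftrightarrow>
    (let F = (\<lambda>s y l. \<Phi> (velocity K (w s) y) (w s y) l) in
      (AE s in lborel. s \<in> {0<..<t} \<longrightarrow>
         integrable lborel (heat_div_integrand (\<nu> * (t - s)) (F s) x)) \<and>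
      set_integrable lborel {0<..<t} (\<lambda>s. heat_conv_div (\<nu> * (t - s)) (F s) x) \<and>
      w t x = heat_conv (\<nu> * t) w0 x
        + (LINT s:{0<..<t}|lborel. heat_conv_div (\<nu> * (t - s)) (F s) x))"

text \<open>
  Strong solutions in \<open>C(I; L\<^sup>p)\<close> on a time interval \<open>I\<close> starting at \<open>0\<close>.  At \<open>t = 0\<close> the integral
  equation reads \<open>\<omega>(0) = \<omega>\<^sub>0\<close>, the convolution with \<open>G\<^sub>0\<close> being the identity; this is stated
  separately because \<open>heat_kernel 0\<close> is a junk value.  Equality in \<open>C(I; L\<^sup>p)\<close> is equality almost
  everywhere in \<open>x\<close> for every time.  Absolute convergence of the Biot--Savart integral is part of the
  definition: it is not automatic for \<open>p \<ge> d\<close>.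
\<close>

definition strong_solution ::
  "('a::euclidean_space \<Rightarrow> 'v::euclidean_space \<Rightarrow> 'a) \<Rightarrow> ('a \<Rightarrow> 'v \<Rightarrow> 'a \<Rightarrow> 'v) \<Rightarrow> real \<Rightarrow>
    ennreal \<Rightarrow> real set \<Rightarrow> ('a \<Rightarrow> 'v) \<Rightarrow> (real \<Rightarrow> 'a \<Rightarrow> 'v) \<Rightarrow> bool" where
  "strong_solution K \<Phi> \<nu> p I w0 w \<longleftrightarrow>
    (\<lambda>(t, x). w t x) \<in> borel_measurable (restrict_space lborel (I \<times> UNIV)) \<and>
    continuous_in_Lp p I w \<and>
    (\<forall>t\<in>I. AE x in lborel. integrable lborel (\<lambda>y. K (x - y) (w t y))) \<and>
    (AE x in lborel. w 0 x = w0 x) \<and>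
    (\<forall>t\<in>I. 0 < t \<longrightarrow> (AE x in lborel. mild_equation_at K \<Phi> \<nu> w0 w t x)) \<and>
    (AE (t, x) in lborel. t \<in> I \<and> 0 < t \<longrightarrow> mild_equation_at K \<Phi> \<nu> w0 w t x)"

definition unique_strong_solution_upto ::
  "('a::euclidean_space \<Rightarrow> 'v::euclidean_space \<Rightarrow> 'a) \<Rightarrow> ('a \<Rightarrow> 'v \<Rightarrow> 'a \<Rightarrow> 'v) \<Rightarrow> real \<Rightarrow>
    ennreal \<Rightarrow> real \<Rightarrow> ('a \<Rightarrow> 'v) \<Rightarrow> bool" where
  "unique_strong_solution_upto K \<Phi> \<nu> p T w0 \<longleftrightarrow>
    (\<exists>w. strong_solution K \<Phi> \<nu> p {0..T} w0 w) \<and>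
    (\<forall>w w'. strong_solution K \<Phi> \<nu> p {0..T} w0 w \<longrightarrow> strong_solution K \<Phi> \<nu> p {0..T} w0 w' \<longrightarrow>
      (\<forall>t\<in>{0..T}. AE x in lborel. w t x = w' t x))"

definition max_lifespan ::
  "('a::euclidean_space \<Rightarrow> 'v::euclidean_space \<Rightarrow> 'a) \<Rightarrow> ('a \<Rightarrow> 'v \<Rightarrow> 'a \<Rightarrow> 'v) \<Rightarrow> real \<Rightarrow>
    ('a \<Rightarrow> 'v) \<Rightarrow> ereal" where
  "max_lifespan K \<Phi> \<nu> w0 =
    Sup {ereal T | T. 0 < T \<and> unique_strong_solution_upto K \<Phi> \<nu> (of_nat (DIM('a) + 1)) T w0}"

text \<open>The strong solution on its maximal interval \<open>[0, T\<^sub>m\<^sub>a\<^sub>x)\<close>, in the class defining \<open>T\<^sub>m\<^sub>a\<^sub>x\<close>.\<close>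

definition maximal_strong_solution ::
  "('a::euclidean_space \<Rightarrow> 'v::euclidean_space \<Rightarrow> 'a) \<Rightarrow> ('a \<Rightarrow> 'v \<Rightarrow> 'a \<Rightarrow> 'v) \<Rightarrow> real \<Rightarrow>
    ('a \<Rightarrow> 'v) \<Rightarrow> (real \<Rightarrow> 'a \<Rightarrow> 'v) \<Rightarrow> bool" where
  "maximal_strong_solution K \<Phi> \<nu> w0 w \<longleftrightarrow>
    0 < max_lifespan K \<Phi> \<nu> w0 \<and>
    strong_solution K \<Phi> \<nu> (of_nat (DIM('a) + 1)) {t. 0 \<le> t \<and> ereal t < max_lifespan K \<Phi> \<nu> w0} w0 w"


section \<open>The two- and three-dimensional equations\<close>

definition perp :: "real^2 \<Rightarrow> real^2" where
  "perp z = vector [- z $ 2, z $ 1]"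

definition biot_savart2 :: "real^2 \<Rightarrow> real \<Rightarrow> real^2" where
  "biot_savart2 z w = (1 / (2 * pi)) *\<^sub>R (w / (norm z)\<^sup>2) *\<^sub>R perp z"

definition flux2 :: "real^2 \<Rightarrow> real \<Rightarrow> real^2 \<Rightarrow> real" where
  "flux2 u w l = - (u \<bullet> l) * w"

definition biot_savart3 :: "real^3 \<Rightarrow> real^3 \<Rightarrow> real^3" where
  "biot_savart3 z w = - (1 / (4 * pi)) *\<^sub>R (1 / norm z ^ 3) *\<^sub>R cross3 z w"

definition flux3 :: "real^3 \<Rightarrow> real^3 \<Rightarrow> real^3 \<Rightarrow> real^3" where
  "flux3 u w l = - (u \<bullet> l) *\<^sub>R w + (w \<bullet> l) *\<^sub>R u"


section \<open>The growth factor\<close>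

text \<open>\<open>z\<^sup>z\<close> on \<open>[0, \<infinity>]\<close> with \<open>0\<^sup>0 = 1\<close> (in contrast to \<open>0 powr 0 = 0\<close>) and \<open>\<infinity>\<^sup>\<infinity> = \<infinity>\<close>.\<close>

definition self_power :: "ennreal \<Rightarrow> ennreal" where
  "self_power z = (if z = 0 then 1 else if z = \<infinity> then \<infinity> else ennreal (enn2real z powr enn2real z))"

definition gaussian_growth_bound ::
  "real \<Rightarrow> real \<Rightarrow> real \<Rightarrow> real \<Rightarrow> real \<Rightarrow> real \<Rightarrow> real \<Rightarrow> ennreal \<Rightarrow> 'a::euclidean_space \<Rightarrow> ennreal" where
  "gaussian_growth_bound A C \<delta> \<nu> \<kappa> \<sigma> t U x =
    ennreal (A * \<kappa>) * self_power (ennreal C * (ennreal t * U\<^sup>2 / ennreal \<nu>)) *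
      ennreal (heat_kernel ((1 + \<delta>) * \<nu> * (\<sigma> + t)) x)"

end

(*
  Pointwise, the mild equation gives |w(t)| <= 3 kappa H(sigma + t) + K|w|(t) with
  K f(t) = c int_0^t (t - s)^(-1/2) H(t - s) * f(s) ds and H(r) = G_{(1 + delta) nu r}, because
  |grad G_r| is at most a multiple of r^(-1/2) G_{(1 + delta) r}; here c is proportional to
  ||u||_infinity / sqrt nu.  By the semigroup property, g(t) = 6 kappa exp(4 pi c^2 t) H(sigma + t)
  satisfies K g <= g / 2 and hence is a supersolution.  The excess h = max 0 (|w| - g) then
  satisfies h <= K h; pairing it with a backward heat flow leaves a scalar Abel inequality for a
  function that is integrable because w lies in C([0,t]; L^p), and so h = 0.  Finally
  exp y <= e y^y converts the exponential in t ||u||^2 / nu into the self power, with a prefactor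
  independent of delta.
*)
theory Submission
  imports Defs "HOL-Probability.Distributions"
begin

section \<open>Gaussian estimates\<close>

text \<open>The velocity enters only through its essential bound \<open>V\<close> and the flux
  through |\<Phi>| \<le> 2 |u| |w|, so the nonlinear equation is read as a linear integral
  inequality for |w|, in both dimensions at once. The obstacle is that nothing is known beforehand
  about the decay of w: no Gaussian-weighted supremum of |w| is known to be finite, so the operator
  term cannot simply be absorbed pointwise. Pairing with a Gaussian asks only for a finite
  space-time integral. The dilation by 1 + \<delta> is paid once: it absorbs the factor |z| / \<tau>
  of the gradient, and since the dilated kernels again form a semigroup, repeated use of K does not
  widen the Gaussian further. The rate 4 pi c^2 is the point where the Laplace transform c sqrt (pi
  / \<lambda>) of the Abel kernel c r^(-1/2) equals 1/2; this is why the exponent is quadratic in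
  the velocity and linear in time.\<close>

lemma heat_kernel_pos: "0 < \<tau> \<Longrightarrow> 0 < heat_kernel \<tau> x"
  by (simp add: heat_kernel_def)

lemma heat_kernel_nonneg: "0 \<le> heat_kernel \<tau> x"
  by (simp add: heat_kernel_def)

lemma heat_kernel_minus: "heat_kernel \<tau> (- x) = heat_kernel \<tau> x"
  by (simp add: heat_kernel_def)

lemma borel_measurable_heat_kernel [measurable]:
  assumes [measurable]: "f \<in> borel_measurable M" "g \<in> borel_measurable M"
  shows "(\<lambda>x. heat_kernel (f x) (g x)) \<in> borel_measurable M"
  unfolding heat_kernel_def by measurable

lemma continuous_heat_kernel: "isCont (heat_kernel \<tau>) x"
  unfolding heat_kernel_def by (cases "\<tau> = 0") (auto intro!: continuous_intros)

text \<open>Heat time \<tau> is variance 2 \<tau> in each coordinate; the factorisation reduces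
  total mass and convolution to facts on one-dimensional normal densities.\<close>

lemma heat_kernel_eq_prod:
  fixes x :: "'a::euclidean_space"
  assumes "0 < \<tau>"
  shows "heat_kernel \<tau> x = (\<Prod>b\<in>Basis. normal_density 0 (sqrt (2 * \<tau>)) (x \<bullet> b))"
proof -
  have "(\<Prod>b\<in>Basis. normal_density 0 (sqrt (2 * \<tau>)) (x \<bullet> b)) =
      (1 / sqrt (4 * pi * \<tau>)) ^ DIM('a) * exp (\<Sum>b\<in>Basis. - ((x \<bullet> b)\<^sup>2 / (4 * \<tau>)))"
    using assms by (simp add: normal_density_def prod.distrib exp_sum algebra_simps divide_simps prod_dividef)
  also have "(1 / sqrt (4 * pi * \<tau>)) ^ DIM('a) = (4 * pi * \<tau>) powr (- real DIM('a) / 2)"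
    using assms by (simp add: powr_half_sqrt[symmetric] powr_minus_divide powr_realpow[symmetric] powr_powr
        power_one_over)
  also have "(\<Sum>b\<in>Basis. - ((x \<bullet> b)\<^sup>2 / (4 * \<tau>))) = - ((norm x)\<^sup>2) / (4 * \<tau>)"
    unfolding euclidean_inner[of x x, folded power2_norm_eq_inner]
    by (simp add: sum_negf sum_divide_distrib power2_eq_square)
  finally show ?thesis
    by (simp add: heat_kernel_def)
qed

text \<open>In each coordinate the variances of the convolved normal densities add. Nonnegative
  integrals allow later use under Tonelli without integrability conditions.\<close>

lemma heat_kernel_semigroup:
  fixes x z :: "'a::euclidean_space"
  assumes "0 < a" "0 < b"
  shows "(\<integral>\<^sup>+y. ennreal (heat_kernel a (x - y)) * ennreal (heat_kernel b (y - z)) \<partial>lborel)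
    = ennreal (heat_kernel (a + b) (x - z))"
proof -
  let ?n = "\<lambda>c. normal_density 0 (sqrt (2 * c))"
  have conv: "(\<integral>\<^sup>+v. ennreal (?n a (p - v) * ?n b (v - q)) \<partial>lborel) = ennreal (?n (a + b) (p - q))"
    for p q :: real
  proof -
    have "(\<integral>\<^sup>+v. ennreal (?n a (p - v) * ?n b (v - q)) \<partial>lborel)
        = (\<integral>\<^sup>+v. ennreal (?n a ((p - q) - v) * ?n b v) \<partial>lborel)"
      by (subst nn_integral_real_affine[where c=1 and t=q]) (simp_all add: algebra_simps)
    also have "\<dots> = ennreal (normal_density 0 (sqrt ((sqrt (2 * a))\<^sup>2 + (sqrt (2 * b))\<^sup>2)) (p - q))"
      using assms by (intro fun_cong[OF conv_normal_density_zero_mean]) auto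
    finally show ?thesis
      using assms by (simp add: algebra_simps)
  qed
  have "(\<integral>\<^sup>+y. ennreal (heat_kernel a (x - y)) * ennreal (heat_kernel b (y - z)) \<partial>lborel) =
      (\<integral>\<^sup>+y. (\<Prod>i\<in>Basis. ennreal (?n a (x \<bullet> i - y \<bullet> i) * ?n b (y \<bullet> i - z \<bullet> i))) \<partial>lborel)"
    using assms by (intro nn_integral_cong)
      (simp add: heat_kernel_eq_prod prod_ennreal prod_nonneg inner_diff_left prod.distrib ennreal_mult[symmetric])
  also have "\<dots> = (\<Prod>i\<in>Basis. \<integral>\<^sup>+v. ennreal (?n a (x \<bullet> i - v) * ?n b (v - z \<bullet> i)) \<partial>lborel)"
    by (rule nn_integral_lborel_prod) auto
  also have "\<dots> = ennreal (heat_kernel (a + b) (x - z))"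
    using assms by (simp add: conv heat_kernel_eq_prod prod_ennreal inner_diff_left)
  finally show ?thesis .
qed

lemma nn_integral_heat_kernel:
  assumes "0 < \<tau>"
  shows "(\<integral>\<^sup>+y. ennreal (heat_kernel \<tau> (y::'a::euclidean_space)) \<partial>lborel) = 1"
proof -
  have "(\<integral>\<^sup>+v. ennreal (normal_density 0 (sqrt (2 * \<tau>)) v) \<partial>lborel) = 1"
    using assms by (subst nn_integral_eq_integral) auto
  moreover have "(\<integral>\<^sup>+y. ennreal (heat_kernel \<tau> (y::'a)) \<partial>lborel) =
      (\<Prod>i\<in>(Basis::'a set). \<integral>\<^sup>+v. ennreal (normal_density 0 (sqrt (2 * \<tau>)) v) \<partial>lborel)"
    using assms by (subst nn_integral_lborel_prod[symmetric])
      (auto simp: heat_kernel_eq_prod prod_ennreal)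
  ultimately show ?thesis
    by simp
qed

text \<open>The exponent splits by 1/\<tau> = \<delta>/((1 + \<delta>) \<tau>) + 1/((1 + \<delta>)
  \<tau>). The first share stays as an explicit factor, to be spent on the polynomial factor of the
  gradient; the second is the wider Gaussian. The 3 bounds the ratio (1 + \<delta>)^(d/2) of the
  normalisations.\<close>

lemma heat_kernel_le_dilate:
  fixes z :: "'a::euclidean_space"
  assumes "0 < \<tau>" "0 < \<delta>" "\<delta> \<le> 1" "DIM('a) \<le> 3"
  shows "heat_kernel \<tau> z \<le> 3 * exp (- (\<delta> * (norm z)\<^sup>2 / (4 * (1 + \<delta>) * \<tau>))) * heat_kernel ((1 + \<delta>) * \<tau>) z"
proof -
  let ?d = "real DIM('a) / 2"
  have "(1 + \<delta>) powr ?d \<le> (1 + \<delta>) powr (3 / 2)"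
    using assms by (intro powr_mono) auto
  also have "\<dots> \<le> 2 powr (3 / 2)"
    using assms by (intro powr_mono2) auto
  \<comment> \<open>Compared after squaring: 8 \<le> 9.\<close>
  also have "\<dots> \<le> 3"
    by (rule power2_le_imp_le) (simp_all add: powr_power powr_numeral)
  finally have dim: "(1 + \<delta>) powr ?d \<le> 3" .
  have "(4 * pi * ((1 + \<delta>) * \<tau>)) powr (- ?d) = (1 + \<delta>) powr (- ?d) * (4 * pi * \<tau>) powr (- ?d)"
    using assms by (subst powr_mult[symmetric]) (auto simp: mult_ac)
  then have "(4 * pi * \<tau>) powr (- ?d) = (1 + \<delta>) powr ?d * (4 * pi * ((1 + \<delta>) * \<tau>)) powr (- ?d)"
    using assms by (simp add: powr_minus)
  moreover have "exp (- ((norm z)\<^sup>2) / (4 * \<tau>)) =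
      exp (- (\<delta> * (norm z)\<^sup>2 / (4 * (1 + \<delta>) * \<tau>))) * exp (- ((norm z)\<^sup>2) / (4 * ((1 + \<delta>) * \<tau>)))"
    unfolding mult_exp_exp using assms by (simp add: divide_simps) (simp add: algebra_simps)
  ultimately have "heat_kernel \<tau> z =
      (1 + \<delta>) powr ?d * (exp (- (\<delta> * (norm z)\<^sup>2 / (4 * (1 + \<delta>) * \<tau>))) * heat_kernel ((1 + \<delta>) * \<tau>) z)"
    by (simp add: heat_kernel_def)
  also have "\<dots> \<le> 3 * (exp (- (\<delta> * (norm z)\<^sup>2 / (4 * (1 + \<delta>) * \<tau>))) * heat_kernel ((1 + \<delta>) * \<tau>) z)"
    using dim by (intro mult_right_mono) (auto intro!: mult_nonneg_nonneg heat_kernel_nonneg)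
  finally show ?thesis
    by simp
qed

section \<open>Gradient of the heat kernel against a dilated Gaussian\<close>

lemma frechet_derivative_heat_kernel:
  assumes "0 < \<tau>"
  shows "frechet_derivative (heat_kernel \<tau>) (at z) l = - (z \<bullet> l) / (2 * \<tau>) * heat_kernel \<tau> z"
proof -
  have "(heat_kernel \<tau> has_derivative (\<lambda>l. - (z \<bullet> l) / (2 * \<tau>) * heat_kernel \<tau> z)) (at z)"
    unfolding heat_kernel_def[abs_def] power2_norm_eq_inner using assms
    by (auto intro!: derivative_eq_intros simp: inner_commute field_simps)
  then show ?thesis
    by (simp add: frechet_derivative_at[symmetric])
qed

text \<open>Uses \<open>y * exp (- y\<^sup>2) \<le> 1\<close> for \<open>y = |z| * sqrt (\<delta> / (4 * (1 + \<delta>) * \<tau>))\<close>.\<close>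

lemma abs_frechet_derivative_heat_kernel_le:
  fixes z l :: "'a::euclidean_space"
  assumes "0 < \<tau>" "0 < \<delta>" "\<delta> \<le> 1" "DIM('a) \<le> 3" "l \<in> Basis"
  shows "\<bar>frechet_derivative (heat_kernel \<tau>) (at z) l\<bar>
    \<le> 3 * sqrt (2 / \<delta>) / sqrt \<tau> * heat_kernel ((1 + \<delta>) * \<tau>) z"
proof -
  define a where "a = \<delta> / (4 * (1 + \<delta>) * \<tau>)"
  have a: "0 < a"
    using assms by (simp add: a_def)
  define y where "y = norm z * sqrt a"
  have y: "0 \<le> y" "y\<^sup>2 = \<delta> * (norm z)\<^sup>2 / (4 * (1 + \<delta>) * \<tau>)" "norm z = y / sqrt a"
    using a by (auto simp: y_def power_mult_distrib) (simp add: a_def)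
  have "y \<le> 1 + y\<^sup>2"
    using sum_squares_bound[of y 1] y(1) by simp
  also have "\<dots> \<le> exp (y\<^sup>2)"
    by simp
  finally have ey: "y * exp (- y\<^sup>2) \<le> 1"
    by (simp add: exp_minus field_simps)
  \<comment> \<open>Both squares equal (1 + \<delta>) / (\<delta> \<tau>); bounding 1 + \<delta> by
    2 then gives the loss \<open>sqrt (2 / \<delta>)\<close>.\<close>
  have "1 / (sqrt a * (2 * \<tau>)) = sqrt ((1 + \<delta>) / \<delta>) / sqrt \<tau>"
  proof (rule power2_eq_imp_eq)
    show "(1 / (sqrt a * (2 * \<tau>)))\<^sup>2 = (sqrt ((1 + \<delta>) / \<delta>) / sqrt \<tau>)\<^sup>2"
      using assms a by (simp add: power_divide power_mult_distrib) (simp add: a_def field_simps power2_eq_square)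
  qed (use assms a in auto)
  also have "\<dots> \<le> sqrt (2 / \<delta>) / sqrt \<tau>"
    using assms by (intro divide_right_mono real_sqrt_le_mono) auto
  finally have sa: "1 / (sqrt a * (2 * \<tau>)) \<le> sqrt (2 / \<delta>) / sqrt \<tau>" .
  have "\<bar>frechet_derivative (heat_kernel \<tau>) (at z) l\<bar> = \<bar>z \<bullet> l\<bar> / (2 * \<tau>) * heat_kernel \<tau> z"
    using assms by (simp add: frechet_derivative_heat_kernel abs_mult heat_kernel_nonneg)
  also have "\<dots> \<le> norm z / (2 * \<tau>) * heat_kernel \<tau> z"
    using assms by (intro mult_right_mono divide_right_mono Basis_le_norm heat_kernel_nonneg) auto
  also have "\<dots> \<le> norm z / (2 * \<tau>) * (3 * exp (- y\<^sup>2) * heat_kernel ((1 + \<delta>) * \<tau>) z)"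
    unfolding y(2) using assms by (intro mult_left_mono heat_kernel_le_dilate) auto
  also have "\<dots> = (y * exp (- y\<^sup>2)) * (1 / (sqrt a * (2 * \<tau>))) * (3 * heat_kernel ((1 + \<delta>) * \<tau>) z)"
    unfolding y(3) by simp
  also have "\<dots> \<le> 1 * (sqrt (2 / \<delta>) / sqrt \<tau>) * (3 * heat_kernel ((1 + \<delta>) * \<tau>) z)"
    using assms a y(1) ey sa by (intro mult_right_mono mult_mono) (auto intro: heat_kernel_nonneg)
  finally show ?thesis
    by (simp add: mult.commute mult.left_commute)
qed

lemma norm_heat_div_integrand_le:
  fixes x y :: "'a::euclidean_space" and F :: "'a \<Rightarrow> 'a \<Rightarrow> 'v::euclidean_space"
  assumes "0 < \<tau>" "0 < \<delta>" "\<delta> \<le> 1" "DIM('a) \<le> 3" "\<And>l. l \<in> Basis \<Longrightarrow> norm (F y l) \<le> m"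
  shows "norm (heat_div_integrand \<tau> F x y) \<le> 9 * sqrt (2 / \<delta>) / sqrt \<tau> * heat_kernel ((1 + \<delta>) * \<tau>) (x - y) * m"
proof -
  let ?B = "3 * sqrt (2 / \<delta>) / sqrt \<tau> * heat_kernel ((1 + \<delta>) * \<tau>) (x - y)"
  \<comment> \<open>The bound at any single basis vector already forces this.\<close>
  have m: "0 \<le> m"
    using assms(5)[OF SOME_Basis] norm_ge_zero order_trans by blast
  have B: "0 \<le> ?B"
    using assms by (auto intro!: mult_nonneg_nonneg divide_nonneg_pos heat_kernel_nonneg)
  \<comment> \<open>The sum over at most three directions turns the 3 of the gradient bound into
    9.\<close>
  have dim: "real DIM('a) * (?B * m) \<le> 3 * (?B * m)"
    using assms(4) by (intro mult_right_mono mult_nonneg_nonneg[OF B m]) auto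
  have "norm (heat_div_integrand \<tau> F x y) \<le>
      (\<Sum>l\<in>Basis. norm (frechet_derivative (heat_kernel \<tau>) (at (x - y)) l *\<^sub>R F y l))"
    unfolding heat_div_integrand_def by (rule norm_sum)
  also have "\<dots> \<le> (\<Sum>l\<in>(Basis::'a set). ?B * m)"
    unfolding norm_scaleR using assms B
    by (intro sum_mono mult_mono abs_frechet_derivative_heat_kernel_le) auto
  also have "\<dots> = real DIM('a) * (?B * m)"
    by simp
  also note dim
  finally show ?thesis
    by (simp add: algebra_simps)
qed

section \<open>The singular Volterra operator\<close>

text \<open>Laplace transform of c r^(-1/2): at rate l it is c \<Gamma>(1/2) / sqrt l = c sqrt (pi /
  l), and l = 4 pi c^2 is chosen to make it 1/2.\<close>

lemma nn_integral_weighted_abel_kernel: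
  fixes c :: real
  assumes "0 < c"
  shows "(\<integral>\<^sup>+r\<in>{0<..}. ennreal (c * r powr (-1/2)) * ennreal (exp (- (4 * pi * c\<^sup>2 * r))) \<partial>lborel) = ennreal (1/2)"
proof -
  define l where "l = 4 * pi * c\<^sup>2"
  have l: "0 < l" "sqrt l = 2 * sqrt pi * c"
    using assms by (auto simp: l_def real_sqrt_mult)
  \<comment> \<open>The integrand of \<Gamma>(1/2). It vanishes at 0 because
    \<open>0 powr a = 0\<close>, which matches the open half-line on the other side.\<close>
  let ?g = "\<lambda>t. ennreal (indicator {0..} t * t powr (1 / 2 - 1) / exp t)"
  have "(\<integral>\<^sup>+r\<in>{0<..}. ennreal (c * r powr (-1/2)) * ennreal (exp (- (l * r))) \<partial>lborel) =
      (\<integral>\<^sup>+r. ennreal (c * sqrt l) * ?g (0 + l * r) \<partial>lborel)"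
  proof (intro nn_integral_cong)
    fix r :: real
    show "ennreal (c * r powr (-1/2)) * ennreal (exp (- (l * r))) * indicator {0<..} r =
        ennreal (c * sqrt l) * ?g (0 + l * r)"
      using l assms by (cases "0 < r"; cases "r = 0")
        (auto simp: ennreal_mult[symmetric] indicator_def zero_le_mult_iff powr_mult powr_minus
          powr_half_sqrt exp_minus field_simps)
  qed
  also have "\<dots> = ennreal (c * sqrt l) * (\<integral>\<^sup>+r. ?g (0 + l * r) \<partial>lborel)"
    by (intro nn_integral_cmult) measurable
  \<comment> \<open>Splitting off a factor \<open>l\<close> supplies the Jacobian of the
    substitution of \<open>l * r\<close> for \<open>r\<close>.\<close>
  also have "c * sqrt l = c * (l / sqrt l)"
    using l(1) by (subst real_div_sqrt) auto
  also have "\<dots> = c / sqrt l * \<bar>l\<bar>"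
    using l(1) by simp
  also have "ennreal \<dots> * (\<integral>\<^sup>+r. ?g (0 + l * r) \<partial>lborel) =
      ennreal (c / sqrt l) * (ennreal \<bar>l\<bar> * (\<integral>\<^sup>+r. ?g (0 + l * r) \<partial>lborel))"
    using l assms by (subst ennreal_mult) (simp_all add: mult.assoc)
  also have "\<dots> = ennreal (c / sqrt l) * (\<integral>\<^sup>+r. ?g r \<partial>lborel)"
    using l by (subst nn_integral_real_affine[of ?g l 0]) auto
  also have "\<dots> = ennreal (c / sqrt l) * ennreal (sqrt pi)"
    by (subst Gamma_conv_nn_integral_real[symmetric]) (auto simp: Gamma_one_half_real)
  also have "\<dots> = ennreal (1 / 2)"
    using l assms by (subst ennreal_mult[symmetric]) auto
  finally show ?thesis
    by (simp add: l_def)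
qed

text \<open>Reversing time by r = t - s pulls out the exponential at time t and leaves a piece of
  the Laplace integral; extending it to the half-line only enlarges it.\<close>

lemma abel_kernel_exp_le:
  fixes c :: real
  assumes "0 < c"
  shows "(\<integral>\<^sup>+s\<in>{0<..<t}. ennreal (c * (t - s) powr (-1/2)) * ennreal (exp (4 * pi * c\<^sup>2 * s)) \<partial>lborel)
    \<le> ennreal (exp (4 * pi * c\<^sup>2 * t) / 2)"
proof -
  define l where "l = 4 * pi * c\<^sup>2"
  let ?h = "\<lambda>r. ennreal (exp (l * t)) * (ennreal (c * r powr (-1/2)) * ennreal (exp (- (l * r))) * indicator {0<..} r)"
  have "(\<integral>\<^sup>+s\<in>{0<..<t}. ennreal (c * (t - s) powr (-1/2)) * ennreal (exp (l * s)) \<partial>lborel) \<le>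
      (\<integral>\<^sup>+s. ?h (t + (-1) * s) \<partial>lborel)"
  proof (intro nn_integral_mono)
    fix s :: real
    have "exp (l * s) = exp (l * t) * exp (- (l * (t - s)))"
      by (simp add: mult_exp_exp algebra_simps)
    then show "ennreal (c * (t - s) powr (-1/2)) * ennreal (exp (l * s)) * indicator {0<..<t} s \<le> ?h (t + (-1) * s)"
      using assms by (auto simp: indicator_def ennreal_mult[symmetric] mult_ac)
  qed
  also have "\<dots> = (\<integral>\<^sup>+r. ?h r \<partial>lborel)"
    by (subst nn_integral_real_affine[of ?h "-1" t]) auto
  also have "\<dots> = ennreal (exp (l * t)) * ennreal (1/2)"
    unfolding nn_integral_weighted_abel_kernel[OF assms, folded l_def, symmetric]
    by (intro nn_integral_cmult) measurable
  also have "\<dots> = ennreal (exp (l * t) / 2)"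
    by (subst ennreal_mult[symmetric]) auto
  finally show ?thesis
    by (simp add: l_def)
qed

text \<open>The same Laplace integral in the other time variable: the decaying weight is a
  supersolution for the transposed kernel, which is what the Gronwall argument tests
  against.\<close>

lemma abel_kernel_exp_adjoint_le:
  fixes c :: real
  assumes "0 < c"
  shows "(\<integral>\<^sup>+t\<in>{s<..}. ennreal (c * (t - s) powr (-1/2)) * ennreal (exp (- (4 * pi * c\<^sup>2 * t))) \<partial>lborel)
    \<le> ennreal (1/2) * ennreal (exp (- (4 * pi * c\<^sup>2 * s)))"
proof -
  define l where "l = 4 * pi * c\<^sup>2"
  let ?h = "\<lambda>t. ennreal (c * (t - s) powr (-1/2)) * ennreal (exp (- (l * t))) * indicator {s<..} t"
  have "(\<integral>\<^sup>+t. ?h t \<partial>lborel) = (\<integral>\<^sup>+r. ?h (s + 1 * r) \<partial>lborel)"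
    by (subst nn_integral_real_affine[of ?h 1 s]) auto
  also have "\<dots> = (\<integral>\<^sup>+r. ennreal (exp (- (l * s))) *
      (ennreal (c * r powr (-1/2)) * ennreal (exp (- (l * r))) * indicator {0<..} r) \<partial>lborel)"
  proof (intro nn_integral_cong)
    fix r :: real
    have "exp (- (l * (s + r))) = exp (- (l * s)) * exp (- (l * r))"
      by (simp add: mult_exp_exp algebra_simps)
    then show "?h (s + 1 * r) = ennreal (exp (- (l * s))) *
      (ennreal (c * r powr (-1/2)) * ennreal (exp (- (l * r))) * indicator {0<..} r)"
      using assms by (auto simp: indicator_def ennreal_mult[symmetric] mult_ac)
  qed
  also have "\<dots> = ennreal (exp (- (l * s))) * ennreal (1/2)"
    unfolding nn_integral_weighted_abel_kernel[OF assms, folded l_def, symmetric]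
    by (intro nn_integral_cmult) measurable
  finally show ?thesis
    by (simp add: l_def mult_ac)
qed

text \<open>In L^1 with weight exp (- 4 pi c^2 t) the Abel operator has norm at most 1/2, by Tonelli
  and the transposed estimate. The weighted integral \<open>N\<close> thus satisfies N \<le> N /
  2.\<close>

lemma abel_gronwall:
  fixes \<eta> :: "real \<Rightarrow> ennreal"
  assumes [measurable]: "\<eta> \<in> borel_measurable borel" and c: "0 < c"
    and le: "\<And>t. t \<in> {0<..<T} \<Longrightarrow> \<eta> t \<le> (\<integral>\<^sup>+s\<in>{0<..<t}. ennreal (c * (t - s) powr (-1/2)) * \<eta> s \<partial>lborel)"
    and fin: "(\<integral>\<^sup>+t\<in>{0<..<T}. \<eta> t \<partial>lborel) < \<infinity>"
  shows "AE t in lborel. t \<in> {0<..<T} \<longrightarrow> \<eta> t = 0"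
proof -
  define e where "e t = ennreal (exp (- (4 * pi * c\<^sup>2 * t)))" for t
  have [measurable]: "e \<in> borel_measurable borel"
    unfolding e_def[abs_def] by measurable
  define N where "N = (\<integral>\<^sup>+t\<in>{0<..<T}. e t * \<eta> t \<partial>lborel)"
  have "N \<le> (\<integral>\<^sup>+t\<in>{0<..<T}. \<eta> t \<partial>lborel)"
    unfolding N_def
  proof (intro nn_integral_mono)
    fix t show "e t * \<eta> t * indicator {0<..<T} t \<le> \<eta> t * indicator {0<..<T} t"
    proof (cases "t \<in> {0<..<T}")
      case True
      then have "e t \<le> 1"
        by (auto simp: e_def)
      then show ?thesis
        using mult_right_mono[of "e t" 1 "\<eta> t"] True by simp
    qed simp
  qed
  with fin have N_fin: "N < \<infinity>"
    by (rule le_less_trans[rotated])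
  have "N \<le> (\<integral>\<^sup>+t. \<integral>\<^sup>+s. e t * indicator {0<..<T} t * indicator {0<..<t} s * ennreal (c * (t - s) powr (-1/2)) * \<eta> s \<partial>lborel \<partial>lborel)"
    unfolding N_def
  proof (intro nn_integral_mono)
    fix t :: real
    show "e t * \<eta> t * indicator {0<..<T} t \<le> (\<integral>\<^sup>+s. e t * indicator {0<..<T} t * indicator {0<..<t} s * ennreal (c * (t - s) powr (-1/2)) * \<eta> s \<partial>lborel)"
    proof (cases "t \<in> {0<..<T}")
      case True
      have "e t * \<eta> t \<le> e t * (\<integral>\<^sup>+s\<in>{0<..<t}. ennreal (c * (t - s) powr (-1/2)) * \<eta> s \<partial>lborel)"
        using le[OF True] by (rule mult_left_mono) simp
      also have "\<dots> = (\<integral>\<^sup>+s. e t * (ennreal (c * (t - s) powr (-1/2)) * \<eta> s * indicator {0<..<t} s) \<partial>lborel)"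
        by (intro nn_integral_cmult[symmetric]) measurable
      finally show ?thesis
        using True by (simp add: mult_ac)
    qed simp
  qed
  also have "\<dots> = (\<integral>\<^sup>+s. \<integral>\<^sup>+t. e t * indicator {0<..<T} t * indicator {0<..<t} s * ennreal (c * (t - s) powr (-1/2)) * \<eta> s \<partial>lborel \<partial>lborel)"
    by (rule lborel_pair.Fubini') (simp add: case_prod_unfold indicator_def)
  also have "\<dots> \<le> (\<integral>\<^sup>+s. ennreal (1/2) * (e s * \<eta> s * indicator {0<..<T} s) \<partial>lborel)"
  proof (intro nn_integral_mono)
    fix s :: real
    have "(\<integral>\<^sup>+t. e t * indicator {0<..<T} t * indicator {0<..<t} s * ennreal (c * (t - s) powr (-1/2)) * \<eta> s \<partial>lborel)
        \<le> (\<integral>\<^sup>+t. (\<eta> s * indicator {0<..<T} s) * (ennreal (c * (t - s) powr (-1/2)) * e t * indicator {s<..} t) \<partial>lborel)"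
      by (intro nn_integral_mono) (auto simp: indicator_def mult_ac)
    also have "\<dots> = (\<eta> s * indicator {0<..<T} s) * (\<integral>\<^sup>+t\<in>{s<..}. ennreal (c * (t - s) powr (-1/2)) * e t \<partial>lborel)"
      by (intro nn_integral_cmult) measurable
    also have "\<dots> \<le> (\<eta> s * indicator {0<..<T} s) * (ennreal (1/2) * e s)"
      unfolding e_def by (intro mult_left_mono abel_kernel_exp_adjoint_le c) auto
    finally show "(\<integral>\<^sup>+t. e t * indicator {0<..<T} t * indicator {0<..<t} s * ennreal (c * (t - s) powr (-1/2)) * \<eta> s \<partial>lborel)
        \<le> ennreal (1/2) * (e s * \<eta> s * indicator {0<..<T} s)"
      by (simp add: mult_ac)
  qed
  also have "\<dots> = ennreal (1/2) * N"
    unfolding N_def by (intro nn_integral_cmult) measurable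
  finally have "N \<le> ennreal (1/2) * N" .
  \<comment> \<open>An infinite \<open>N\<close> would satisfy the inequality as well;
    \<open>N_fin\<close> excludes it.\<close>
  have "N = 0"
  proof (cases N)
    case (real r)
    then have "ennreal r \<le> ennreal (1/2 * r)"
      using \<open>N \<le> ennreal (1/2) * N\<close> by (subst ennreal_mult) auto
    then show ?thesis
      using real by (auto simp: ennreal_le_iff)
  qed (use N_fin in auto)
  then have "AE t in lborel. e t * \<eta> t * indicator {0<..<T} t = 0"
    unfolding N_def by (subst (asm) nn_integral_0_iff_AE) auto
  then show ?thesis
    by eventually_elim (auto simp: e_def indicator_def split: if_splits)
qed

section \<open>The space-time operator and the comparison principle\<close>

definition heat_abel_op :: "real \<Rightarrow> real \<Rightarrow> (real \<Rightarrow> 'a::euclidean_space \<Rightarrow> ennreal) \<Rightarrow> real \<Rightarrow> 'a \<Rightarrow> ennreal" where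
  "heat_abel_op c \<mu> f t x = (\<integral>\<^sup>+s\<in>{0<..<t}. ennreal (c * (t - s) powr (-1/2)) *
     (\<integral>\<^sup>+y. ennreal (heat_kernel (\<mu> * (t - s)) (x - y)) * f s y \<partial>lborel) \<partial>lborel)"

lemma heat_abel_op_mono:
  "(\<And>s y. f s y \<le> g s y) \<Longrightarrow> heat_abel_op c \<mu> f t x \<le> heat_abel_op c \<mu> g t x"
  unfolding heat_abel_op_def by (intro nn_integral_mono mult_right_mono mult_left_mono) auto

lemma heat_abel_op_add:
  assumes [measurable]: "case_prod f \<in> borel_measurable (lborel \<Otimes>\<^sub>M lborel)"
    "case_prod g \<in> borel_measurable (lborel \<Otimes>\<^sub>M lborel)"
  shows "heat_abel_op c \<mu> (\<lambda>s y. f s y + g s y) t x = heat_abel_op c \<mu> f t x + heat_abel_op c \<mu> g t x"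
proof -
  have "(\<integral>\<^sup>+y. ennreal (heat_kernel (\<mu> * (t - s)) (x - y)) * (f s y + g s y) \<partial>lborel) =
     (\<integral>\<^sup>+y. ennreal (heat_kernel (\<mu> * (t - s)) (x - y)) * f s y \<partial>lborel) +
     (\<integral>\<^sup>+y. ennreal (heat_kernel (\<mu> * (t - s)) (x - y)) * g s y \<partial>lborel)" for s
    unfolding distrib_left by (intro nn_integral_add) measurable
  then show ?thesis
    unfolding heat_abel_op_def
    by (subst nn_integral_add[symmetric]) (simp_all add: distrib_left distrib_right)
qed

text \<open>The heat times \<mu> (t - s) and \<mu> (\<sigma> + s) add up to \<mu> (\<sigma> + t),
  independent of s. So the Gaussian leaves the time integral, and the scalar Abel estimate gives the
  factor 1/2.\<close>

lemma heat_abel_op_gaussian_le: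
  assumes "0 < c" "0 < \<mu>" "0 < \<sigma>" "0 \<le> M"
  shows "heat_abel_op c \<mu> (\<lambda>s y. ennreal (M * exp (4 * pi * c\<^sup>2 * s) * heat_kernel (\<mu> * (\<sigma> + s)) y)) t x
    \<le> ennreal (M / 2 * exp (4 * pi * c\<^sup>2 * t) * heat_kernel (\<mu> * (\<sigma> + t)) x)"
proof -
  let ?H = "ennreal (M * heat_kernel (\<mu> * (\<sigma> + t)) x)"
  have conv: "(\<integral>\<^sup>+y. ennreal (heat_kernel (\<mu> * (t - s)) (x - y)) *
      ennreal (M * exp (4 * pi * c\<^sup>2 * s) * heat_kernel (\<mu> * (\<sigma> + s)) y) \<partial>lborel) =
      ennreal (exp (4 * pi * c\<^sup>2 * s)) * ?H" if "s \<in> {0<..<t}" for s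
  proof -
    have "(\<integral>\<^sup>+y. ennreal (heat_kernel (\<mu> * (t - s)) (x - y)) *
        ennreal (M * exp (4 * pi * c\<^sup>2 * s) * heat_kernel (\<mu> * (\<sigma> + s)) y) \<partial>lborel) =
        (\<integral>\<^sup>+y. ennreal (M * exp (4 * pi * c\<^sup>2 * s)) * (ennreal (heat_kernel (\<mu> * (t - s)) (x - y)) *
        ennreal (heat_kernel (\<mu> * (\<sigma> + s)) (y - 0))) \<partial>lborel)"
      using assms by (intro nn_integral_cong) (simp add: ennreal_mult heat_kernel_nonneg mult_ac)
    also have "\<dots> = ennreal (M * exp (4 * pi * c\<^sup>2 * s)) *
        ennreal (heat_kernel (\<mu> * (t - s) + \<mu> * (\<sigma> + s)) (x - 0))"
      using assms that by (subst nn_integral_cmult) (auto simp: heat_kernel_semigroup[where z = 0, simplified])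
    also have "\<mu> * (t - s) + \<mu> * (\<sigma> + s) = \<mu> * (\<sigma> + t)"
      by (simp add: algebra_simps)
    finally show ?thesis
      using assms by (simp add: ennreal_mult heat_kernel_nonneg mult_ac)
  qed
  have "heat_abel_op c \<mu> (\<lambda>s y. ennreal (M * exp (4 * pi * c\<^sup>2 * s) * heat_kernel (\<mu> * (\<sigma> + s)) y)) t x =
      (\<integral>\<^sup>+s. ?H * (ennreal (c * (t - s) powr (-1/2)) * ennreal (exp (4 * pi * c\<^sup>2 * s)) * indicator {0<..<t} s) \<partial>lborel)"
    unfolding heat_abel_op_def
  proof (intro nn_integral_cong)
    fix s :: real
    show "ennreal (c * (t - s) powr (-1/2)) * (\<integral>\<^sup>+y. ennreal (heat_kernel (\<mu> * (t - s)) (x - y)) *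
        ennreal (M * exp (4 * pi * c\<^sup>2 * s) * heat_kernel (\<mu> * (\<sigma> + s)) y) \<partial>lborel) * indicator {0<..<t} s =
        ?H * (ennreal (c * (t - s) powr (-1/2)) * ennreal (exp (4 * pi * c\<^sup>2 * s)) * indicator {0<..<t} s)"
    proof (cases "s \<in> {0<..<t}")
      case True
      show ?thesis
        unfolding conv[OF True] by (simp only: mult_ac)
    qed simp
  qed
  also have "\<dots> = ?H * (\<integral>\<^sup>+s\<in>{0<..<t}. ennreal (c * (t - s) powr (-1/2)) * ennreal (exp (4 * pi * c\<^sup>2 * s)) \<partial>lborel)"
    by (intro nn_integral_cmult) measurable
  also have "\<dots> \<le> ?H * ennreal (exp (4 * pi * c\<^sup>2 * t) / 2)"
    by (intro mult_left_mono abel_kernel_exp_le assms) auto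
  finally show ?thesis
    using assms by (simp add: ennreal_mult[symmetric] heat_kernel_nonneg mult_ac)
qed

text \<open>Pairing with a backward heat flow turns the semigroup into a scalar convolution in time.\<close>

lemma nn_integral_heat_kernel_heat_abel_op:
  assumes [measurable]: "case_prod f \<in> borel_measurable (lborel \<Otimes>\<^sub>M lborel)" and "0 < \<mu>" "t < T"
  shows "(\<integral>\<^sup>+x. ennreal (heat_kernel (\<mu> * (T - t)) x) * heat_abel_op c \<mu> f t x \<partial>lborel) =
    (\<integral>\<^sup>+s\<in>{0<..<t}. ennreal (c * (t - s) powr (-1/2)) *
      (\<integral>\<^sup>+y. ennreal (heat_kernel (\<mu> * (T - s)) y) * f s y \<partial>lborel) \<partial>lborel)"
proof -
  let ?a = "\<lambda>s. ennreal (c * (t - s) powr (-1/2)) * indicator {0<..<t} s"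
  let ?k = "\<lambda>r x. ennreal (heat_kernel (\<mu> * r) x)"
  have "(\<integral>\<^sup>+x. ?k (T - t) x * heat_abel_op c \<mu> f t x \<partial>lborel) =
      (\<integral>\<^sup>+x. \<integral>\<^sup>+s. ?k (T - t) x * (?a s * (\<integral>\<^sup>+y. ?k (t - s) (x - y) * f s y \<partial>lborel)) \<partial>lborel \<partial>lborel)"
    unfolding heat_abel_op_def by (subst nn_integral_cmult[symmetric]) (simp_all add: mult_ac)
  also have "\<dots> = (\<integral>\<^sup>+s. \<integral>\<^sup>+x. ?k (T - t) x * (?a s * (\<integral>\<^sup>+y. ?k (t - s) (x - y) * f s y \<partial>lborel)) \<partial>lborel \<partial>lborel)"
    by (rule lborel_pair.Fubini') measurable
  also have "\<dots> = (\<integral>\<^sup>+s. ?a s * (\<integral>\<^sup>+y. ?k (T - s) y * f s y \<partial>lborel) \<partial>lborel)"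
  proof (intro nn_integral_cong)
    fix s :: real
    show "(\<integral>\<^sup>+x. ?k (T - t) x * (?a s * (\<integral>\<^sup>+y. ?k (t - s) (x - y) * f s y \<partial>lborel)) \<partial>lborel) =
      ?a s * (\<integral>\<^sup>+y. ?k (T - s) y * f s y \<partial>lborel)"
    proof (cases "s \<in> {0<..<t}")
      case True
      have "(\<integral>\<^sup>+x. ?k (T - t) x * (?a s * (\<integral>\<^sup>+y. ?k (t - s) (x - y) * f s y \<partial>lborel)) \<partial>lborel) =
          ?a s * (\<integral>\<^sup>+x. \<integral>\<^sup>+y. ?k (T - t) x * (?k (t - s) (x - y) * f s y) \<partial>lborel \<partial>lborel)"
        by (subst nn_integral_cmult[symmetric], measurable)+ (simp add: mult_ac)
      also have "(\<integral>\<^sup>+x. \<integral>\<^sup>+y. ?k (T - t) x * (?k (t - s) (x - y) * f s y) \<partial>lborel \<partial>lborel) =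
          (\<integral>\<^sup>+y. \<integral>\<^sup>+x. ?k (T - t) x * (?k (t - s) (x - y) * f s y) \<partial>lborel \<partial>lborel)"
        by (rule lborel_pair.Fubini') measurable
      \<comment> \<open>Evenness turns the backward kernel at \<open>x\<close> into one at
        \<open>0 - x\<close>, the shape of the semigroup law with endpoints \<open>0\<close> and
        \<open>y\<close>.\<close>
      also have "\<dots> = (\<integral>\<^sup>+y. f s y * (\<integral>\<^sup>+x. ?k (T - t) (0 - x) * ?k (t - s) (x - y) \<partial>lborel) \<partial>lborel)"
        by (subst nn_integral_cmult[symmetric], measurable)
          (simp add: mult_ac heat_kernel_minus)
      also have "\<dots> = (\<integral>\<^sup>+y. ?k (T - s) y * f s y \<partial>lborel)"
      proof -
        have "\<mu> * (T - t) + \<mu> * (t - s) = \<mu> * (T - s)"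
          by (simp add: algebra_simps)
        then show ?thesis
          using True assms by (subst heat_kernel_semigroup) (auto simp: heat_kernel_minus mult_ac)
      qed
      finally show ?thesis .
    qed simp
  qed
  finally show ?thesis
    by (simp add: mult_ac)
qed

text \<open>The free term carries M / 2 because the supersolution \<open>g\<close> of amplitude M
  spends one half of itself on it and the other half on K g \<le> g / 2. The backward kernel is
  aimed at time T + 1, not T, so that it stays regular up to t = T.\<close>

lemma heat_abel_comparison:
  fixes f :: "real \<Rightarrow> 'a::euclidean_space \<Rightarrow> ennreal"
  assumes f [measurable]: "case_prod f \<in> borel_measurable (lborel \<Otimes>\<^sub>M lborel)"
    and pos: "0 < c" "0 < \<mu>" "0 < \<sigma>" "0 \<le> M" "0 < T"
    and le: "\<And>t. t \<in> {0<..T} \<Longrightarrow> AE x in lborel. f t x \<le>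
      ennreal (M / 2 * heat_kernel (\<mu> * (\<sigma> + t)) x) + heat_abel_op c \<mu> f t x"
    and fin: "(\<integral>\<^sup>+t\<in>{0<..<T}. (\<integral>\<^sup>+x. ennreal (heat_kernel (\<mu> * (T + 1 - t)) x) * f t x \<partial>lborel) \<partial>lborel) < \<infinity>"
  shows "AE x in lborel. f T x \<le> ennreal (M * exp (4 * pi * c\<^sup>2 * T) * heat_kernel (\<mu> * (\<sigma> + T)) x)"
proof -
  define g where "g t x = ennreal (M * exp (4 * pi * c\<^sup>2 * t) * heat_kernel (\<mu> * (\<sigma> + t)) x)" for t and x :: 'a
  have [measurable]: "case_prod g \<in> borel_measurable (lborel \<Otimes>\<^sub>M lborel)"
    unfolding g_def[abs_def] by measurable
  \<comment> \<open>Truncated subtraction on \<open>ennreal\<close> is the positive part, so f \<le>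
    g + h everywhere.\<close>
  define h where "h t x = f t x - g t x" for t x
  have [measurable]: "case_prod h \<in> borel_measurable (lborel \<Otimes>\<^sub>M lborel)"
    unfolding h_def[abs_def] by measurable
  have hK: "AE x in lborel. h t x \<le> heat_abel_op c \<mu> h t x" if t: "t \<in> {0<..T}" for t
    using le[OF t]
  proof eventually_elim
    fix x
    assume fx: "f t x \<le> ennreal (M / 2 * heat_kernel (\<mu> * (\<sigma> + t)) x) + heat_abel_op c \<mu> f t x"
    have "1 \<le> exp (4 * pi * c\<^sup>2 * t)"
      using t by simp
    then have "M / 2 * heat_kernel (\<mu> * (\<sigma> + t)) x * 1 \<le> M / 2 * heat_kernel (\<mu> * (\<sigma> + t)) x * exp (4 * pi * c\<^sup>2 * t)"
      using pos by (intro mult_left_mono mult_nonneg_nonneg heat_kernel_nonneg) auto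
    then have half: "ennreal (M / 2 * heat_kernel (\<mu> * (\<sigma> + t)) x) \<le>
        ennreal (M / 2 * exp (4 * pi * c\<^sup>2 * t) * heat_kernel (\<mu> * (\<sigma> + t)) x)"
      by (intro ennreal_leI) (simp add: mult_ac)
    have "heat_abel_op c \<mu> f t x \<le> heat_abel_op c \<mu> (\<lambda>s y. g s y + h s y) t x"
      by (intro heat_abel_op_mono) (auto simp: h_def add_diff_self_ennreal)
    also have "\<dots> = heat_abel_op c \<mu> g t x + heat_abel_op c \<mu> h t x"
      by (rule heat_abel_op_add) measurable
    also have "\<dots> \<le> ennreal (M / 2 * exp (4 * pi * c\<^sup>2 * t) * heat_kernel (\<mu> * (\<sigma> + t)) x) + heat_abel_op c \<mu> h t x"
      unfolding g_def using pos by (intro add_right_mono heat_abel_op_gaussian_le) auto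
    finally have "f t x \<le> ennreal (M / 2 * exp (4 * pi * c\<^sup>2 * t) * heat_kernel (\<mu> * (\<sigma> + t)) x) +
        (ennreal (M / 2 * exp (4 * pi * c\<^sup>2 * t) * heat_kernel (\<mu> * (\<sigma> + t)) x) + heat_abel_op c \<mu> h t x)"
      using order_trans[OF fx add_mono[OF half]] by blast
    also have "\<dots> = g t x + heat_abel_op c \<mu> h t x"
      unfolding add.assoc[symmetric] g_def using pos
      by (subst ennreal_plus[symmetric]) (auto simp: mult_ac intro!: mult_nonneg_nonneg heat_kernel_nonneg)
    \<comment> \<open>Subtracting \<open>g\<close> is legitimate because \<open>g\<close> is
      finite.\<close>
    finally show "h t x \<le> heat_abel_op c \<mu> h t x"
      unfolding h_def g_def by (subst ennreal_minus_le_iff) auto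
  qed
  define \<eta> where "\<eta> t = (\<integral>\<^sup>+x. ennreal (heat_kernel (\<mu> * (T + 1 - t)) x) * h t x \<partial>lborel)" for t
  have "AE t in lborel. t \<in> {0<..<T} \<longrightarrow> \<eta> t = 0"
  proof (rule abel_gronwall)
    show "\<eta> \<in> borel_measurable borel"
      unfolding \<eta>_def[abs_def] by measurable
    have "(\<integral>\<^sup>+t\<in>{0<..<T}. \<eta> t \<partial>lborel) \<le>
        (\<integral>\<^sup>+t\<in>{0<..<T}. (\<integral>\<^sup>+x. ennreal (heat_kernel (\<mu> * (T + 1 - t)) x) * f t x \<partial>lborel) \<partial>lborel)"
      unfolding \<eta>_def by (intro nn_integral_mono mult_right_mono mult_left_mono) (auto simp: h_def diff_le_self_ennreal)
    with fin show "(\<integral>\<^sup>+t\<in>{0<..<T}. \<eta> t \<partial>lborel) < \<infinity>"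
      by (rule le_less_trans[rotated])
  next
    fix t assume t: "t \<in> {0<..<T}"
    have "\<eta> t \<le> (\<integral>\<^sup>+x. ennreal (heat_kernel (\<mu> * (T + 1 - t)) x) * heat_abel_op c \<mu> h t x \<partial>lborel)"
      unfolding \<eta>_def
    proof (rule nn_integral_mono_AE)
      show "AE x in lborel. ennreal (heat_kernel (\<mu> * (T + 1 - t)) x) * h t x \<le>
          ennreal (heat_kernel (\<mu> * (T + 1 - t)) x) * heat_abel_op c \<mu> h t x"
        using hK[of t] t by (auto elim!: eventually_mono intro: mult_left_mono)
    qed
    also have "\<dots> = (\<integral>\<^sup>+s\<in>{0<..<t}. ennreal (c * (t - s) powr (-1/2)) * \<eta> s \<partial>lborel)"
      unfolding \<eta>_def using pos t by (intro nn_integral_heat_kernel_heat_abel_op) auto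
    finally show "\<eta> t \<le> (\<integral>\<^sup>+s\<in>{0<..<t}. ennreal (c * (t - s) powr (-1/2)) * \<eta> s \<partial>lborel)" .
  qed (rule pos)
  then have null: "AE s in lborel. s \<in> {0<..<T} \<longrightarrow> (AE y in lborel. h s y = 0)"
  proof eventually_elim
    fix s assume s: "s \<in> {0<..<T} \<longrightarrow> \<eta> s = 0"
    show "s \<in> {0<..<T} \<longrightarrow> (AE y in lborel. h s y = 0)"
    proof
      assume sT: "s \<in> {0<..<T}"
      then have "AE y in lborel. ennreal (heat_kernel (\<mu> * (T + 1 - s)) y) * h s y = 0"
        using s unfolding \<eta>_def by (subst (asm) nn_integral_0_iff_AE) auto
      then show "AE y in lborel. h s y = 0"
      proof eventually_elim
        fix y assume *: "ennreal (heat_kernel (\<mu> * (T + 1 - s)) y) * h s y = 0"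
        have "0 < heat_kernel (\<mu> * (T + 1 - s)) y"
          using sT pos by (intro heat_kernel_pos) auto
        with * show "h s y = 0"
          by auto
      qed
    qed
  qed
  \<comment> \<open>Gronwall controls only almost every time before \<open>T\<close>. The time
    \<open>T\<close> itself is reached by one more use of h \<le> K h, since K h at \<open>T\<close>
    sees only earlier times, up to null sets.\<close>
  have "heat_abel_op c \<mu> h T x = 0" for x
  proof -
    have "heat_abel_op c \<mu> h T x = (\<integral>\<^sup>+s. 0 \<partial>(lborel :: real measure))"
      unfolding heat_abel_op_def
    proof (rule nn_integral_cong_AE, use null in eventually_elim)
      fix s assume s: "s \<in> {0<..<T} \<longrightarrow> (AE y in lborel. h s y = 0)"
      show "ennreal (c * (T - s) powr (-1/2)) *
          (\<integral>\<^sup>+y. ennreal (heat_kernel (\<mu> * (T - s)) (x - y)) * h s y \<partial>lborel) * indicator {0<..<T} s = 0"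
      proof (cases "s \<in> {0<..<T}")
        case True
        with s have "(\<integral>\<^sup>+y. ennreal (heat_kernel (\<mu> * (T - s)) (x - y)) * h s y \<partial>lborel) = (\<integral>\<^sup>+y. 0 \<partial>(lborel :: 'a measure))"
          by (intro nn_integral_cong_AE) auto
        then show ?thesis
          by simp
      qed simp
    qed
    then show ?thesis
      by simp
  qed
  with hK[of T] pos have "AE x in lborel. h T x = 0"
    by simp
  then show ?thesis
    by eventually_elim (simp add: h_def g_def diff_eq_0_iff_ennreal)
qed

section \<open>Boundedness of moments\<close>

text \<open>Unconditional, because the Bochner integral of a non-integrable function is 0.\<close>

lemma norm_integral_le_nn_integral:
  fixes f :: "'b \<Rightarrow> 'v::{banach, second_countable_topology}"
  shows "ennreal (norm (integral\<^sup>L M f)) \<le> (\<integral>\<^sup>+x. ennreal (norm (f x)) \<partial>M)"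
  using integral_norm_bound_ennreal[of M f] by (cases "integrable M f") (auto simp: not_integrable_integral_eq)

text \<open>The moment \<open>\<integral>|f|\<^sup>p\<close> replaces the norm itself, since it only needs crude additivity instead of
  Minkowski's inequality.\<close>

lemma nn_integral_powr_norm_le:
  fixes f g :: "'a::euclidean_space \<Rightarrow> 'v::euclidean_space"
  assumes [measurable]: "f \<in> borel_measurable borel" "g \<in> borel_measurable borel" and "0 < p"
  shows "(\<integral>\<^sup>+x. ennreal (norm (f x) powr p) \<partial>lborel) \<le>
    ennreal (2 powr p) * ((\<integral>\<^sup>+x. ennreal (norm (f x - g x) powr p) \<partial>lborel) + (\<integral>\<^sup>+x. ennreal (norm (g x) powr p) \<partial>lborel))"
proof -
  have "(\<integral>\<^sup>+x. ennreal (norm (f x) powr p) \<partial>lborel) \<le>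
      (\<integral>\<^sup>+x. ennreal (2 powr p) * (ennreal (norm (f x - g x) powr p) + ennreal (norm (g x) powr p)) \<partial>lborel)"
  proof (intro nn_integral_mono)
    fix x
    let ?a = "norm (f x - g x)" and ?b = "norm (g x)"
    have "norm (f x) \<le> 2 * max ?a ?b"
      using norm_triangle_ineq[of "f x - g x" "g x"] by simp
    then have "norm (f x) powr p \<le> (2 * max ?a ?b) powr p"
      using assms by (intro powr_mono2) auto
    also have "\<dots> \<le> 2 powr p * (?a powr p + ?b powr p)"
      by (auto simp: powr_mult max_def)
    finally show "ennreal (norm (f x) powr p) \<le> ennreal (2 powr p) * (ennreal (?a powr p) + ennreal (?b powr p))"
      by (simp add: ennreal_mult[symmetric] ennreal_plus[symmetric] del: ennreal_plus)
  qed
  also have "\<dots> = ennreal (2 powr p) * ((\<integral>\<^sup>+x. ennreal (norm (f x - g x) powr p) \<partial>lborel) + (\<integral>\<^sup>+x. ennreal (norm (g x) powr p) \<partial>lborel))"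
    by (subst nn_integral_cmult, measurable) (subst nn_integral_add, measurable)
  finally show ?thesis .
qed

text \<open>Continuity bounds the moment near each time, and compactness of [0, T] makes the bound
  uniform.\<close>

lemma continuous_in_Lp_bounded:
  fixes w :: "real \<Rightarrow> 'a::euclidean_space \<Rightarrow> 'v::euclidean_space"
  assumes w: "continuous_in_Lp q I w" and I: "{0..T} \<subseteq> I" and q: "0 < q" "q < \<infinity>"
  shows "\<exists>Q. \<forall>s\<in>{0..T}. (\<integral>\<^sup>+x. ennreal (norm (w s x) powr enn2real q) \<partial>lborel) \<le> ennreal Q"
proof -
  define p where "p = enn2real q"
  have p: "0 < p" "q \<noteq> \<infinity>"
    using q by (auto simp: p_def enn2real_positive_iff)
  let ?J = "\<lambda>f::'a \<Rightarrow> 'v. \<integral>\<^sup>+x. ennreal (norm (f x) powr p) \<partial>lborel"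
  have J_fin: "?J f < \<infinity>" if "Lp_norm q lborel f < \<infinity>" for f
    using that p by (auto simp: Lp_norm_def Let_def p_def[symmetric] less_top split: if_splits)
  have J_le_1: "?J f \<le> 1" if "Lp_norm q lborel f < 1" for f
  proof (cases "?J f")
    case (real r)
    then have "Lp_norm q lborel f = ennreal (r powr (1 / p))"
      using p by (simp add: Lp_norm_def Let_def p_def[symmetric])
    then have "r powr (1 / p) < 1"
      using that by simp
    then have "r \<le> 1"
      using p(1) ge_one_powr_ge_zero[of r "1 / p"] by (intro leI notI) auto
    then show ?thesis
      using real by simp
  next
    case top
    moreover have "Lp_norm q lborel f < \<infinity>"
      using that by (rule less_trans) simp
    ultimately show ?thesis
      using J_fin[of f] by simp
  qed
  have loc: "\<exists>e>0. \<exists>Q. \<forall>s\<in>I. dist s t < e \<longrightarrow> ?J (w s) \<le> ennreal Q" if t: "t \<in> {0..T}" for t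
  proof -
    have tI: "t \<in> I"
      using I t by auto
    have meas: "w s \<in> borel_measurable borel" if "s \<in> I" for s
      using w that by (auto simp: continuous_in_Lp_def Lp_space_def)
    have "Lp_norm q lborel (w t) < \<infinity>"
      using w tI by (auto simp: continuous_in_Lp_def Lp_space_def)
    then obtain b where b: "0 \<le> b" "?J (w t) = ennreal b"
      using J_fin[of "w t"] by (cases "?J (w t)") auto
    have "((\<lambda>s. Lp_norm q lborel (\<lambda>x. w s x - w t x)) \<longlongrightarrow> 0) (at t within I)"
      using w tI by (auto simp: continuous_in_Lp_def)
    then have "eventually (\<lambda>s. Lp_norm q lborel (\<lambda>x. w s x - w t x) < 1) (at t within I)"
      by (rule order_tendstoD) simp
    then obtain e where e: "0 < e" "\<And>s. s \<in> I \<Longrightarrow> s \<noteq> t \<Longrightarrow> dist s t < e \<Longrightarrow> Lp_norm q lborel (\<lambda>x. w s x - w t x) < 1"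
      by (auto simp: eventually_at)
    \<comment> \<open>The limit at \<open>t\<close> ignores \<open>s = t\<close>; the extra summand
      \<open>b\<close> covers that time.\<close>
    have "?J (w s) \<le> ennreal (2 powr p * (1 + b) + b)" if s: "s \<in> I" "dist s t < e" for s
    proof (cases "s = t")
      case True
      then show ?thesis
        using b by (auto intro!: ennreal_leI)
    next
      case False
      have "?J (w s) \<le> ennreal (2 powr p) * (?J (\<lambda>x. w s x - w t x) + ?J (w t))"
        using meas s tI p by (intro nn_integral_powr_norm_le) auto
      also have "\<dots> \<le> ennreal (2 powr p) * (1 + ennreal b)"
        using J_le_1[OF e(2)[OF s(1) False s(2)]] b by (intro mult_left_mono add_mono) auto
      also have "\<dots> = ennreal (2 powr p * (1 + b))"
        using b by (simp add: ennreal_mult)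
      also have "\<dots> \<le> ennreal (2 powr p * (1 + b) + b)"
        using b by (intro ennreal_leI) auto
      finally show ?thesis .
    qed
    with e(1) show ?thesis
      by blast
  qed
  then obtain e Q where eQ: "\<And>t. t \<in> {0..T} \<Longrightarrow> 0 < e t"
      "\<And>t s. t \<in> {0..T} \<Longrightarrow> s \<in> I \<Longrightarrow> dist s t < e t \<Longrightarrow> ?J (w s) \<le> ennreal (Q t)"
    by metis
  have "{0..T} \<subseteq> (\<Union>t\<in>{0..T}. ball t (e t))"
    using eQ(1) by force
  then obtain D where D: "D \<subseteq> {0..T}" "finite D" "{0..T} \<subseteq> (\<Union>t\<in>D. ball t (e t))"
    using compactE_image[OF compact_Icc[of 0 T], of "{0..T}" "\<lambda>t. ball t (e t)"] by auto
  \<comment> \<open>Absolute values keep the sum above each single \<open>Q t\<close>, whose sign is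
    unknown.\<close>
  have "?J (w s) \<le> ennreal (\<Sum>t\<in>D. \<bar>Q t\<bar>)" if s: "s \<in> {0..T}" for s
  proof -
    obtain t where t: "t \<in> D" "dist s t < e t"
      using D(3) s by (auto simp: dist_commute)
    then have "?J (w s) \<le> ennreal (Q t)"
      using D(1) I s by (intro eQ(2)) auto
    also have "Q t \<le> (\<Sum>t\<in>D. \<bar>Q t\<bar>)"
      using t(1) D(2) order_trans[OF abs_ge_self member_le_sum[of t D "\<lambda>t. \<bar>Q t\<bar>"]] by auto
    finally show ?thesis
      by (simp add: ennreal_leI)
  qed
  then show ?thesis
    unfolding p_def by blast
qed

text \<open>A split at |w| = 1 takes the place of Hoelder's inequality: where |w| \<le> 1 the kernel
  alone dominates, and it has mass 1; elsewhere |w| \<le> |w|^p and the kernel is bounded.\<close>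

lemma continuous_in_Lp_heat_moment_finite:
  fixes w :: "real \<Rightarrow> 'a::euclidean_space \<Rightarrow> 'v::euclidean_space"
  assumes w: "continuous_in_Lp q I w" and I: "{0..T} \<subseteq> I" and q: "1 \<le> q" "q < \<infinity>" and \<mu>: "0 < \<mu>"
  shows "(\<integral>\<^sup>+t\<in>{0<..<T}. (\<integral>\<^sup>+x. ennreal (heat_kernel (\<mu> * (T + 1 - t)) x) * ennreal (norm (w t x)) \<partial>lborel) \<partial>lborel) < \<infinity>"
proof -
  define p where "p = enn2real q"
  have p: "1 \<le> p"
    using q enn2real_mono[of 1 q] by (auto simp: p_def)
  obtain Q where Q: "\<And>s. s \<in> {0..T} \<Longrightarrow> (\<integral>\<^sup>+x. ennreal (norm (w s x) powr p) \<partial>lborel) \<le> ennreal Q"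
    using continuous_in_Lp_bounded[OF w I] q unfolding p_def by (metis less_le_trans zero_less_one)
  \<comment> \<open>The peak of the kernel at time \<mu>, hence a bound at all later times \<mu> (T
    + 1 - t).\<close>
  define P where "P = (4 * pi * \<mu>) powr (- real DIM('a) / 2)"
  have P: "0 \<le> P"
    by (simp add: P_def)
  have inner: "(\<integral>\<^sup>+x. ennreal (heat_kernel (\<mu> * (T + 1 - t)) x) * ennreal (norm (w t x)) \<partial>lborel)
      \<le> ennreal P * ennreal Q + 1" if t: "t \<in> {0<..<T}" for t
  proof -
    let ?k = "\<lambda>x. heat_kernel (\<mu> * (T + 1 - t)) x"
    have [measurable]: "w t \<in> borel_measurable borel"
      using w t I by (auto simp: continuous_in_Lp_def Lp_space_def subset_eq)
    have k_le: "?k x \<le> P" for x :: 'a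
    proof -
      have "(4 * pi * (\<mu> * (T + 1 - t))) powr (- real DIM('a) / 2) \<le> P"
        unfolding P_def using t \<mu> by (intro powr_mono2') auto
      moreover have "exp (- ((norm x)\<^sup>2) / (4 * (\<mu> * (T + 1 - t)))) \<le> 1"
        using t \<mu> by auto
      ultimately show ?thesis
        unfolding heat_kernel_def using mult_mono[of _ P _ 1] P by fastforce
    qed
    have "(\<integral>\<^sup>+x. ennreal (?k x) * ennreal (norm (w t x)) \<partial>lborel) \<le>
        (\<integral>\<^sup>+x. ennreal P * ennreal (norm (w t x) powr p) + ennreal (?k x) \<partial>lborel)"
    proof (intro nn_integral_mono)
      fix x
      have "?k x * norm (w t x) \<le> P * (norm (w t x) powr p) + ?k x"
      proof (cases "norm (w t x) \<le> 1")
        case True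
        then have "?k x * norm (w t x) \<le> ?k x"
          by (intro mult_left_le heat_kernel_nonneg)
        then show ?thesis
          using P by (simp add: add_increasing)
      next
        case False
        then have "norm (w t x) \<le> norm (w t x) powr p"
          using p powr_mono[of 1 p "norm (w t x)"] by simp
        then have "?k x * norm (w t x) \<le> P * norm (w t x) powr p"
          using k_le[of x] P by (intro mult_mono) auto
        then show ?thesis
          using heat_kernel_nonneg[of "\<mu> * (T + 1 - t)" x] by simp
      qed
      then show "ennreal (?k x) * ennreal (norm (w t x)) \<le> ennreal P * ennreal (norm (w t x) powr p) + ennreal (?k x)"
        using P by (simp add: ennreal_mult[symmetric] ennreal_plus[symmetric] heat_kernel_nonneg del: ennreal_plus)
    qed
    also have "\<dots> = ennreal P * (\<integral>\<^sup>+x. ennreal (norm (w t x) powr p) \<partial>lborel) + 1"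
      using t \<mu> by (subst nn_integral_add, measurable) (subst nn_integral_cmult, measurable, simp add: nn_integral_heat_kernel)
    also have "\<dots> \<le> ennreal P * ennreal Q + 1"
      using Q[of t] t by (intro add_mono mult_left_mono) auto
    finally show ?thesis .
  qed
  have "(\<integral>\<^sup>+t\<in>{0<..<T}. (\<integral>\<^sup>+x. ennreal (heat_kernel (\<mu> * (T + 1 - t)) x) * ennreal (norm (w t x)) \<partial>lborel) \<partial>lborel)
      \<le> (\<integral>\<^sup>+t\<in>{0<..<T}. (ennreal P * ennreal Q + 1) \<partial>lborel)"
    using inner by (intro nn_integral_mono) (auto simp: indicator_def)
  also have "\<dots> = (ennreal P * ennreal Q + 1) * emeasure lborel {0<..<T}"
    by (intro nn_integral_cmult_indicator) auto
  also have "\<dots> < \<infinity>"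
    by (cases "0 \<le> T") (auto simp: ennreal_mult_less_top)
  finally show ?thesis .
qed

section \<open>The Gaussian bound\<close>

text \<open>The datum lies below a Gaussian, and heat flow merely advances the time of a
  Gaussian.\<close>

lemma norm_heat_conv_le:
  fixes w0 :: "'a::euclidean_space \<Rightarrow> 'v::euclidean_space"
  assumes "AE x in lborel. norm (w0 x) \<le> \<kappa> * heat_kernel a x" "0 < a" "0 < b" "0 < \<kappa>"
  shows "ennreal (norm (heat_conv b w0 x)) \<le> ennreal (\<kappa> * heat_kernel (a + b) x)"
proof -
  have "ennreal (norm (heat_conv b w0 x)) \<le> (\<integral>\<^sup>+y. ennreal (norm (heat_kernel b (x - y) *\<^sub>R w0 y)) \<partial>lborel)"
    unfolding heat_conv_def by (rule norm_integral_le_nn_integral)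
  also have "\<dots> \<le> (\<integral>\<^sup>+y. ennreal \<kappa> * (ennreal (heat_kernel b (x - y)) * ennreal (heat_kernel a (y - 0))) \<partial>lborel)"
  proof (rule nn_integral_mono_AE, use assms(1) in eventually_elim)
    fix y assume "norm (w0 y) \<le> \<kappa> * heat_kernel a y"
    then have "heat_kernel b (x - y) * norm (w0 y) \<le> heat_kernel b (x - y) * (\<kappa> * heat_kernel a y)"
      by (intro mult_left_mono heat_kernel_nonneg)
    then show "ennreal (norm (heat_kernel b (x - y) *\<^sub>R w0 y)) \<le>
        ennreal \<kappa> * (ennreal (heat_kernel b (x - y)) * ennreal (heat_kernel a (y - 0)))"
      using assms by (simp add: ennreal_mult[symmetric] heat_kernel_nonneg mult_ac)
  qed
  also have "\<dots> = ennreal \<kappa> * ennreal (heat_kernel (b + a) (x - 0))"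
    using assms heat_kernel_semigroup[of b a x 0] by (subst nn_integral_cmult) auto
  finally show ?thesis
    using assms by (simp add: ennreal_mult heat_kernel_nonneg add.commute)
qed

text \<open>Norms move inside the Duhamel integral. The gradient bound at time \<nu> (t - s) yields
  both the Abel weight and the dilated kernel, and the velocity is replaced by its bound
  \<open>V\<close>. The free term is widened to the same family of kernels at the cost of a factor
  3.\<close>

lemma mild_equation_gaussian_inequality:
  fixes w :: "real \<Rightarrow> 'a::euclidean_space \<Rightarrow> 'v::euclidean_space"
  assumes mild: "mild_equation_at K \<Phi> \<nu> w0 w t x"
    and dim: "DIM('a) \<le> 3"
    and \<Phi>: "\<And>u v l. l \<in> Basis \<Longrightarrow> norm (\<Phi> u v l) \<le> 2 * norm u * norm v"
    and w: "\<And>s. s \<in> {0<..<t} \<Longrightarrow> w s \<in> borel_measurable borel"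
    and V: "AE s in lborel. s \<in> {0<..<t} \<longrightarrow> (AE y in lborel. norm (velocity K (w s) y) \<le> V)" "0 < V"
    and w0: "AE x in lborel. norm (w0 x) \<le> \<kappa> * heat_kernel (\<nu> * \<sigma>) x"
    and pos: "0 < \<nu>" "0 < \<kappa>" "0 < \<sigma>" "0 < t"
    and \<delta>: "0 < \<delta>" "\<delta> \<le> 1"
  shows "ennreal (norm (w t x)) \<le> ennreal (3 * \<kappa> * heat_kernel ((1 + \<delta>) * \<nu> * (\<sigma> + t)) x) +
    heat_abel_op (18 * sqrt (2 / \<delta>) * V / sqrt \<nu>) ((1 + \<delta>) * \<nu>) (\<lambda>s y. ennreal (norm (w s y))) t x"
proof -
  define F where "F s y l = \<Phi> (velocity K (w s) y) (w s y) l" for s y l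
  define c where "c = 18 * sqrt (2 / \<delta>) * V / sqrt \<nu>"
  have c: "0 < c"
    using \<delta> pos V by (simp add: c_def)
  let ?G = "\<lambda>s. heat_conv_div (\<nu> * (t - s)) (F s) x"
  have "w t x = heat_conv (\<nu> * t) w0 x + (LINT s:{0<..<t}|lborel. ?G s)"
    using mild by (simp add: mild_equation_at_def Let_def F_def[abs_def])
  then have "ennreal (norm (w t x)) \<le> ennreal (norm (heat_conv (\<nu> * t) w0 x)) + ennreal (norm (LINT s:{0<..<t}|lborel. ?G s))"
    by (simp add: norm_triangle_ineq ennreal_plus[symmetric] ennreal_leI del: ennreal_plus)
  moreover have "ennreal (norm (heat_conv (\<nu> * t) w0 x)) \<le> ennreal (3 * \<kappa> * heat_kernel ((1 + \<delta>) * \<nu> * (\<sigma> + t)) x)"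
  proof -
    have "ennreal (norm (heat_conv (\<nu> * t) w0 x)) \<le> ennreal (\<kappa> * heat_kernel (\<nu> * \<sigma> + \<nu> * t) x)"
      using w0 pos by (intro norm_heat_conv_le) auto
    also have "\<kappa> * heat_kernel (\<nu> * \<sigma> + \<nu> * t) x \<le>
        \<kappa> * (3 * exp (- (\<delta> * (norm x)\<^sup>2 / (4 * (1 + \<delta>) * (\<nu> * \<sigma> + \<nu> * t)))) * heat_kernel ((1 + \<delta>) * (\<nu> * \<sigma> + \<nu> * t)) x)"
      using pos \<delta> dim by (intro mult_left_mono heat_kernel_le_dilate add_pos_pos) auto
    also have "\<dots> \<le> \<kappa> * (3 * 1 * heat_kernel ((1 + \<delta>) * (\<nu> * \<sigma> + \<nu> * t)) x)"
      using pos \<delta> by (intro mult_left_mono mult_right_mono heat_kernel_nonneg) auto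
    finally show ?thesis
      by (simp add: ennreal_leI algebra_simps)
  qed
  moreover have "ennreal (norm (LINT s:{0<..<t}|lborel. ?G s)) \<le> heat_abel_op c ((1 + \<delta>) * \<nu>) (\<lambda>s y. ennreal (norm (w s y))) t x"
  proof -
    have "ennreal (norm (LINT s:{0<..<t}|lborel. ?G s)) \<le> (\<integral>\<^sup>+s. ennreal (norm (indicator {0<..<t} s *\<^sub>R ?G s)) \<partial>lborel)"
      unfolding set_lebesgue_integral_def by (rule norm_integral_le_nn_integral)
    also have "\<dots> \<le> heat_abel_op c ((1 + \<delta>) * \<nu>) (\<lambda>s y. ennreal (norm (w s y))) t x"
      unfolding heat_abel_op_def
    proof (rule nn_integral_mono_AE, use V(1) in eventually_elim)
      fix s assume Vs: "s \<in> {0<..<t} \<longrightarrow> (AE y in lborel. norm (velocity K (w s) y) \<le> V)"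
      let ?k = "\<lambda>y. heat_kernel ((1 + \<delta>) * \<nu> * (t - s)) (x - y)"
      show "ennreal (norm (indicator {0<..<t} s *\<^sub>R ?G s)) \<le>
          ennreal (c * (t - s) powr (-1/2)) * (\<integral>\<^sup>+y. ennreal (?k y) * ennreal (norm (w s y)) \<partial>lborel) * indicator {0<..<t} s"
      proof (cases "s \<in> {0<..<t}")
        case True
        have [measurable]: "w s \<in> borel_measurable borel"
          by (rule w[OF True])
        \<comment> \<open>The 9 of the divergence bound times the 2 of the flux bound is the 18 in
          \<open>c\<close>.\<close>
        have cs: "9 * sqrt (2 / \<delta>) / sqrt (\<nu> * (t - s)) * (2 * V) = c * (t - s) powr (-1/2)"
          using True pos by (simp add: c_def real_sqrt_mult powr_minus powr_half_sqrt divide_simps)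
        have "ennreal (norm (?G s)) \<le> (\<integral>\<^sup>+y. ennreal (norm (heat_div_integrand (\<nu> * (t - s)) (F s) x y)) \<partial>lborel)"
          unfolding heat_conv_div_def by (rule norm_integral_le_nn_integral)
        also have "\<dots> \<le> (\<integral>\<^sup>+y. ennreal (c * (t - s) powr (-1/2)) * (ennreal (?k y) * ennreal (norm (w s y))) \<partial>lborel)"
        proof (rule nn_integral_mono_AE, use Vs[rule_format, OF True] in eventually_elim)
          fix y assume Vy: "norm (velocity K (w s) y) \<le> V"
          have "norm (F s y l) \<le> 2 * V * norm (w s y)" if "l \<in> Basis" for l
            unfolding F_def using order_trans[OF \<Phi>[OF that]] Vy by (meson mult_left_mono mult_right_mono norm_ge_zero zero_le_numeral)
          then have "norm (heat_div_integrand (\<nu> * (t - s)) (F s) x y) \<le>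
              9 * sqrt (2 / \<delta>) / sqrt (\<nu> * (t - s)) * heat_kernel ((1 + \<delta>) * (\<nu> * (t - s))) (x - y) * (2 * V * norm (w s y))"
            using True pos \<delta> dim by (intro norm_heat_div_integrand_le) auto
          also have "\<dots> = (9 * sqrt (2 / \<delta>) / sqrt (\<nu> * (t - s)) * (2 * V)) * (?k y * norm (w s y))"
            by (simp add: mult_ac)
          also note cs
          finally show "ennreal (norm (heat_div_integrand (\<nu> * (t - s)) (F s) x y)) \<le>
              ennreal (c * (t - s) powr (-1/2)) * (ennreal (?k y) * ennreal (norm (w s y)))"
            using c by (simp add: ennreal_mult[symmetric] heat_kernel_nonneg ennreal_leI)
        qed
        also have "\<dots> = ennreal (c * (t - s) powr (-1/2)) * (\<integral>\<^sup>+y. ennreal (?k y) * ennreal (norm (w s y)) \<partial>lborel)"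
          by (intro nn_integral_cmult) measurable
        finally show ?thesis
          using True by simp
      qed simp
    qed
    finally show ?thesis .
  qed
  ultimately show ?thesis
    unfolding c_def by (meson add_mono order_trans)
qed

text \<open>The comparison principle with M = 6 \<kappa>, twice the amplitude 3 \<kappa> of the free
  term.\<close>

lemma strong_solution_gaussian_bound:
  fixes w :: "real \<Rightarrow> 'a::euclidean_space \<Rightarrow> 'v::euclidean_space"
  assumes sol: "strong_solution K \<Phi> \<nu> q I w0 w"
    and q: "1 \<le> q" "q < \<infinity>"
    and I: "{0..T} \<subseteq> I" "I \<in> sets borel"
    and dim: "DIM('a) \<le> 3"
    and \<Phi>: "\<And>u v l. l \<in> Basis \<Longrightarrow> norm (\<Phi> u v l) \<le> 2 * norm u * norm v"
    and V: "AE s in lborel. s \<in> {0<..<T} \<longrightarrow> (AE y in lborel. norm (velocity K (w s) y) \<le> V)" "0 < V"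
    and w0: "AE x in lborel. norm (w0 x) \<le> \<kappa> * heat_kernel (\<nu> * \<sigma>) x"
    and pos: "0 < \<nu>" "0 < \<kappa>" "0 < \<sigma>" "0 < T"
    and \<delta>: "0 < \<delta>" "\<delta> \<le> 1"
  shows "AE x in lborel. ennreal (norm (w T x)) \<le>
    ennreal (6 * \<kappa> * exp (2592 * pi / \<delta> * (T * V\<^sup>2 / \<nu>)) * heat_kernel ((1 + \<delta>) * \<nu> * (\<sigma> + T)) x)"
proof -
  define c where "c = 18 * sqrt (2 / \<delta>) * V / sqrt \<nu>"
  \<comment> \<open>Joint measurability of \<open>w\<close> is given only on
    \<open>I \<times> UNIV\<close>. Extension by zero makes \<open>f\<close> measurable everywhere
    and does not change the operator at times in (0, T].\<close>
  define f where "f s y = ennreal (norm (w s y)) * indicator I s" for s y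
  have cont: "continuous_in_Lp q I w"
    using sol by (simp add: strong_solution_def)
  \<comment> \<open>4 pi times 18^2 times 2 / \<delta>.\<close>
  have exponent: "4 * pi * c\<^sup>2 * T = 2592 * pi / \<delta> * (T * V\<^sup>2 / \<nu>)"
    using pos \<delta> by (simp add: c_def power_mult_distrib power_divide)
  have op_cong: "heat_abel_op c \<mu> f t x = heat_abel_op c \<mu> (\<lambda>s y. ennreal (norm (w s y))) t x"
    if "t \<in> {0<..T}" for \<mu> t x
    unfolding heat_abel_op_def using that I(1)
    by (intro nn_integral_cong) (auto simp: f_def indicator_def subset_eq split: if_splits)
  have "AE x in lborel. f T x \<le> ennreal (6 * \<kappa> * exp (4 * pi * c\<^sup>2 * T) * heat_kernel ((1 + \<delta>) * \<nu> * (\<sigma> + T)) x)"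
  proof (rule heat_abel_comparison)
    have "I \<times> UNIV \<inter> space lborel \<in> sets (lborel :: (real \<times> 'a) measure)"
      using I(2) by (simp add: borel_Times)
    moreover have "(\<lambda>(t, x). w t x) \<in> borel_measurable (restrict_space lborel (I \<times> UNIV))"
      using sol by (simp add: strong_solution_def)
    then have "(\<lambda>z. ennreal (norm (case z of (t, x) \<Rightarrow> w t x))) \<in> borel_measurable (restrict_space lborel (I \<times> UNIV))"
      by measurable
    ultimately have "(\<lambda>z. ennreal (norm (case z of (t, x) \<Rightarrow> w t x)) * indicator (I \<times> UNIV) z) \<in>
        borel_measurable (lborel :: (real \<times> 'a) measure)"
      by (subst (asm) borel_measurable_restrict_space_iff_ennreal)
    also have "(\<lambda>z. ennreal (norm (case z of (t, x) \<Rightarrow> w t x)) * indicator (I \<times> UNIV) z) = case_prod f"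
      by (auto simp: f_def indicator_def)
    finally show "case_prod f \<in> borel_measurable (lborel \<Otimes>\<^sub>M lborel)"
      by (simp add: lborel_prod)
  next
    fix t assume t: "t \<in> {0<..T}"
    then have "AE x in lborel. mild_equation_at K \<Phi> \<nu> w0 w t x"
      using sol I(1) by (auto simp: strong_solution_def subset_eq)
    then show "AE x in lborel. f t x \<le> ennreal (6 * \<kappa> / 2 * heat_kernel ((1 + \<delta>) * \<nu> * (\<sigma> + t)) x) +
        heat_abel_op c ((1 + \<delta>) * \<nu>) f t x"
    proof eventually_elim
      fix x assume mild: "mild_equation_at K \<Phi> \<nu> w0 w t x"
      have "w s \<in> borel_measurable borel" if "s \<in> {0<..<t}" for s
        using cont that t I(1) by (auto simp: continuous_in_Lp_def Lp_space_def subset_eq)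
      moreover have "AE s in lborel. s \<in> {0<..<t} \<longrightarrow> (AE y in lborel. norm (velocity K (w s) y) \<le> V)"
        using V(1) t by (auto elim!: eventually_mono)
      ultimately have "ennreal (norm (w t x)) \<le> ennreal (3 * \<kappa> * heat_kernel ((1 + \<delta>) * \<nu> * (\<sigma> + t)) x) +
          heat_abel_op c ((1 + \<delta>) * \<nu>) (\<lambda>s y. ennreal (norm (w s y))) t x"
        unfolding c_def using t by (intro mild_equation_gaussian_inequality[OF mild dim \<Phi> _ _ V(2) w0 pos(1-3) _ \<delta>]) auto
      moreover have "f t x \<le> ennreal (norm (w t x))"
        by (simp add: f_def indicator_def)
      ultimately show "f t x \<le> ennreal (6 * \<kappa> / 2 * heat_kernel ((1 + \<delta>) * \<nu> * (\<sigma> + t)) x) +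
          heat_abel_op c ((1 + \<delta>) * \<nu>) f t x"
        by (simp add: op_cong[OF t])
    qed
  next
    have "(\<integral>\<^sup>+t\<in>{0<..<T}. (\<integral>\<^sup>+x. ennreal (heat_kernel ((1 + \<delta>) * \<nu> * (T + 1 - t)) x) * f t x \<partial>lborel) \<partial>lborel) \<le>
        (\<integral>\<^sup>+t\<in>{0<..<T}. (\<integral>\<^sup>+x. ennreal (heat_kernel ((1 + \<delta>) * \<nu> * (T + 1 - t)) x) * ennreal (norm (w t x)) \<partial>lborel) \<partial>lborel)"
      by (intro nn_integral_mono mult_right_mono mult_left_mono) (auto simp: f_def indicator_def)
    also have "\<dots> < \<infinity>"
      using pos \<delta> by (intro continuous_in_Lp_heat_moment_finite[OF cont I(1) q]) auto
    finally show "(\<integral>\<^sup>+t\<in>{0<..<T}. (\<integral>\<^sup>+x. ennreal (heat_kernel ((1 + \<delta>) * \<nu> * (T + 1 - t)) x) * f t x \<partial>lborel) \<partial>lborel) < \<infinity>" .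
  qed (use pos \<delta> V(2) in \<open>auto simp: c_def\<close>)
  then show ?thesis
    using I(1) pos by (simp add: exponent f_def subset_eq)
qed

text \<open>\<open>y * ln y \<ge> y - 1\<close>, so the base of the self power absorbs an exponential.\<close>

lemma exp_le_self_power:
  assumes "0 < y"
  shows "ennreal (exp y) \<le> ennreal (exp 1) * self_power (ennreal y)"
proof -
  have "1 - 1 / y \<le> ln y"
    using ln_le_minus_one[of "1 / y"] assms by (simp add: ln_div)
  then have "y * (1 - 1 / y) \<le> y * ln y"
    using assms by (intro mult_left_mono) auto
  then have "exp y \<le> exp (1 + y * ln y)"
    using assms by (simp add: algebra_simps)
  also have "\<dots> = exp 1 * y powr y"
    using assms by (simp add: exp_add powr_def)
  finally show ?thesis
    using assms by (simp add: self_power_def ennreal_mult[symmetric] ennreal_leI)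
qed

section \<open>From space-time null sets to time slices and to single points\<close>

lemma sup_norm_upto_AE:
  assumes "sup_norm_upto t u \<le> ennreal V" "0 \<le> V"
  shows "AE s in lborel. s \<in> {0<..<t} \<longrightarrow> (AE y in lborel. norm (u s y) \<le> V)"
proof -
  let ?S = "{0<..<t} \<times> (UNIV :: 'a set)"
  have "AE z in restrict_space lborel ?S. ennreal (norm (case z of (s, y) \<Rightarrow> u s y)) \<le> sup_norm_upto t u"
    unfolding sup_norm_upto_def Lp_norm_def by simp (rule esssup_AE)
  moreover have "?S \<inter> space lborel \<in> sets lborel"
    by (simp add: borel_Times)
  ultimately have "AE z in lborel. z \<in> ?S \<longrightarrow> ennreal (norm (case z of (s, y) \<Rightarrow> u s y)) \<le> sup_norm_upto t u"
    by (simp add: AE_restrict_space_iff)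
  then have "AE z in lborel \<Otimes>\<^sub>M lborel. z \<in> ?S \<longrightarrow> norm (case z of (s, y) \<Rightarrow> u s y) \<le> V"
    unfolding lborel_prod
  proof (rule eventually_mono, intro impI)
    fix z :: "real \<times> 'a"
    assume "z \<in> ?S \<longrightarrow> ennreal (norm (case z of (s, y) \<Rightarrow> u s y)) \<le> sup_norm_upto t u" "z \<in> ?S"
    then have "ennreal (norm (case z of (s, y) \<Rightarrow> u s y)) \<le> ennreal V"
      using assms(1) by (meson order_trans)
    then show "norm (case z of (s, y) \<Rightarrow> u s y) \<le> V"
      using assms(2) by (simp add: ennreal_le_iff)
  qed
  \<comment> \<open>By Fubini a null set of space-time has null sections at almost every
    time.\<close>
  then show ?thesis
    by (rule lborel_pair.AE_pair[THEN eventually_mono]) auto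
qed

text \<open>A strict violation at \<open>x\<close> separates the two values by some \<open>m\<close>
  and persists on an open neighbourhood, which cannot be null.\<close>

lemma AE_le_imp_le_isCont:
  fixes f :: "'a::euclidean_space \<Rightarrow> ennreal"
  assumes "AE x in lborel. f x \<le> g x" "isCont f x" "isCont g x"
  shows "f x \<le> g x"
proof (rule ccontr)
  assume "\<not> f x \<le> g x"
  then obtain m where m: "g x < m" "m < f x"
    using dense by (metis not_le)
  have "eventually (\<lambda>y. g y < m \<and> m < f y) (nhds x)"
    using assms(2,3) m unfolding isCont_def tendsto_at_iff_tendsto_nhds
    by (intro eventually_conj order_tendstoD)
  then obtain S where S: "open S" "x \<in> S" "\<And>y. y \<in> S \<Longrightarrow> g y < m \<and> m < f y"
    unfolding eventually_nhds by blast
  have "AE y in lborel. y \<notin> S"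
    using assms(1) by eventually_elim (use S(3) in force)
  then have "S \<in> null_sets lborel"
    using S(1) by (subst (asm) AE_iff_null_sets[symmetric]) auto
  then have "negligible S"
    by (simp add: negligible_iff_null_sets null_sets_completionI)
  with S open_not_negligible show False
    by blast
qed

lemma isCont_gaussian_growth_bound:
  fixes x :: "'a::euclidean_space"
  assumes "0 < A" "0 < \<kappa>" "0 < \<sigma>" "0 \<le> t" "0 < \<nu>" "0 < \<delta>"
  shows "isCont (gaussian_growth_bound A C \<delta> \<nu> \<kappa> \<sigma> t U) x"
proof -
  define r where "r = ennreal (A * \<kappa>) * self_power (ennreal C * (ennreal t * U\<^sup>2 / ennreal \<nu>))"
  define \<tau> where "\<tau> = (1 + \<delta>) * \<nu> * (\<sigma> + t)"
  have \<tau>: "0 < \<tau>"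
    using assms by (simp add: \<tau>_def)
  have eq: "gaussian_growth_bound A C \<delta> \<nu> \<kappa> \<sigma> t U = (\<lambda>x::'a. r * ennreal (heat_kernel \<tau> x))"
    by (simp add: fun_eq_iff gaussian_growth_bound_def r_def \<tau>_def)
  show ?thesis
  proof (cases r)
    case (real r')
    then have "gaussian_growth_bound A C \<delta> \<nu> \<kappa> \<sigma> t U = (\<lambda>x::'a. ennreal (r' * heat_kernel \<tau> x))"
      by (simp add: eq ennreal_mult heat_kernel_nonneg)
    moreover have "isCont (\<lambda>x::'a. ennreal (r' * heat_kernel \<tau> x)) x"
      using continuous_heat_kernel[of x \<tau>] unfolding isCont_def by (intro tendsto_intros tendsto_ennrealI)
    ultimately show ?thesis
      by simp
  next
    case top
    \<comment> \<open>Positivity matters since infinity times 0 is 0 in \<open>ennreal\<close>; with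
      it the product is constantly infinite.\<close>
    have "ennreal (heat_kernel \<tau> y) \<noteq> 0" for y :: 'a
      using heat_kernel_pos[OF \<tau>, of y] by (simp add: ennreal_eq_0_iff not_le)
    then have "gaussian_growth_bound A C \<delta> \<nu> \<kappa> \<sigma> t U = (\<lambda>x::'a. top)"
      by (simp add: eq top ennreal_top_mult)
    then show ?thesis
      by simp
  qed
qed

lemma maximal_strong_solution_gaussian_growth_bound:
  fixes w :: "real \<Rightarrow> 'a::euclidean_space \<Rightarrow> 'v::euclidean_space"
  assumes sol: "maximal_strong_solution K \<Phi> \<nu> w0 w"
    and t: "0 \<le> t" "ereal t < max_lifespan K \<Phi> \<nu> w0"
    and dim: "DIM('a) \<le> 3"
    and \<Phi>: "\<And>u v l. l \<in> Basis \<Longrightarrow> norm (\<Phi> u v l) \<le> 2 * norm u * norm v"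
    and w0: "AE x in lborel. norm (w0 x) \<le> \<kappa> * heat_kernel (\<nu> * \<sigma>) x"
    and pos: "0 < \<nu>" "0 < \<kappa>" "0 < \<sigma>"
    and \<delta>: "0 < \<delta>" "\<delta> \<le> 1"
  shows "AE x in lborel. ennreal (norm (w t x)) \<le> gaussian_growth_bound (6 * exp 1) (2592 * pi / \<delta>) \<delta> \<nu> \<kappa> \<sigma> t
    (sup_norm_upto t (\<lambda>s. velocity K (w s))) x"
proof -
  define I where "I = {t. 0 \<le> t \<and> ereal t < max_lifespan K \<Phi> \<nu> w0}"
  define U where "U = sup_norm_upto t (\<lambda>s. velocity K (w s))"
  define C where "C = 2592 * pi / \<delta>"
  have C: "0 < C"
    using \<delta> by (simp add: C_def)
  let ?H = "\<lambda>x. heat_kernel ((1 + \<delta>) * \<nu> * (\<sigma> + t)) x"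
  have sol': "strong_solution K \<Phi> \<nu> (of_nat (DIM('a) + 1)) I w0 w"
    using sol by (simp add: maximal_strong_solution_def I_def)
  have bound: "AE x in lborel. ennreal (norm (w t x)) \<le> ennreal (6 * \<kappa> * exp (C * (t * V\<^sup>2 / \<nu>)) * ?H x)"
    if "0 < t" "U \<le> ennreal V" "0 < V" for V
    unfolding C_def
  proof (rule strong_solution_gaussian_bound[OF sol'])
    show "{0..t} \<subseteq> I"
      using t(2) by (auto simp: I_def intro: le_less_trans[of _ "ereal t"])
    show "I \<in> sets borel"
      unfolding I_def by measurable
    show "AE s in lborel. s \<in> {0<..<t} \<longrightarrow> (AE y in lborel. norm (velocity K (w s) y) \<le> V)"
      using that unfolding U_def by (intro sup_norm_upto_AE) auto
    show "(1::ennreal) \<le> of_nat (DIM('a) + 1)"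
      by simp
    show "of_nat (DIM('a) + 1) < (\<infinity>::ennreal)"
      by (simp only: infinity_ennreal_def of_nat_less_top)
  qed (use that dim \<Phi> w0 pos \<delta> in auto)
  consider "t = 0" | "0 < t" "U = \<infinity>" | "0 < t" "U = 0" | u where "0 < t" "U = ennreal u" "0 < u"
    using t(1) by (cases U) (auto simp: less_le)
  then have "AE x in lborel. ennreal (norm (w t x)) \<le> gaussian_growth_bound (6 * exp 1) C \<delta> \<nu> \<kappa> \<sigma> t U x"
  proof cases
    case 1
    \<comment> \<open>At time 0 the argument of the self power is 0 whatever \<open>U\<close> is, so
      the factor is 1 and only the widening of the initial Gaussian is to be paid.\<close>
    have "AE x in lborel. w 0 x = w0 x"
      using sol' by (simp add: strong_solution_def)
    with w0 show ?thesis
    proof eventually_elim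
      fix x assume x: "norm (w0 x) \<le> \<kappa> * heat_kernel (\<nu> * \<sigma>) x" "w 0 x = w0 x"
      have "heat_kernel (\<nu> * \<sigma>) x \<le> 3 * exp (- (\<delta> * (norm x)\<^sup>2 / (4 * (1 + \<delta>) * (\<nu> * \<sigma>)))) * heat_kernel ((1 + \<delta>) * (\<nu> * \<sigma>)) x"
        using pos \<delta> dim by (intro heat_kernel_le_dilate) auto
      also have "\<dots> \<le> 3 * 1 * heat_kernel ((1 + \<delta>) * (\<nu> * \<sigma>)) x"
        using pos \<delta> by (intro mult_left_mono mult_right_mono heat_kernel_nonneg) auto
      also have "\<dots> \<le> 6 * exp 1 * heat_kernel ((1 + \<delta>) * (\<nu> * \<sigma>)) x"
        using exp_ge_add_one_self[of 1] by (intro mult_right_mono heat_kernel_nonneg) auto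
      finally have "\<kappa> * heat_kernel (\<nu> * \<sigma>) x \<le> \<kappa> * (6 * exp 1 * heat_kernel ((1 + \<delta>) * (\<nu> * \<sigma>)) x)"
        using pos by (intro mult_left_mono) auto
      with x(1) have "norm (w0 x) \<le> 6 * exp 1 * \<kappa> * heat_kernel ((1 + \<delta>) * \<nu> * \<sigma>) x"
        by (simp add: mult_ac)
      then show "ennreal (norm (w t x)) \<le> gaussian_growth_bound (6 * exp 1) C \<delta> \<nu> \<kappa> \<sigma> t U x"
        using pos by (simp add: 1 x(2) gaussian_growth_bound_def self_power_def ennreal_mult[symmetric] heat_kernel_nonneg ennreal_leI)
    qed
  next
    case 2
    \<comment> \<open>The right-hand side is infinite at every point, because \<open>C\<close>,
      \<open>t\<close> and the kernel are positive.\<close>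
    have "?H x > 0" for x :: 'a
      using pos \<delta> t by (intro heat_kernel_pos) auto
    then have "gaussian_growth_bound (6 * exp 1) C \<delta> \<nu> \<kappa> \<sigma> t U x = \<infinity>" for x :: 'a
      using 2 C pos by (simp add: gaussian_growth_bound_def self_power_def ennreal_mult_top ennreal_top_mult ennreal_top_divide
        ennreal_eq_0_iff not_le)
    then show ?thesis
      by simp
  next
    case 3
    \<comment> \<open>With \<open>U = 0\<close> every positive \<open>V\<close> is allowed. This one
      makes the exponent 1, and \<open>exp 1\<close> fits into the prefactor, the self power being 1
      by the convention on 0^0.\<close>
    have V: "C * (t * (sqrt (\<nu> / (C * t)))\<^sup>2 / \<nu>) = 1"
      using 3 C pos by simp
    have "AE x in lborel. ennreal (norm (w t x)) \<le> ennreal (6 * \<kappa> * exp 1 * ?H x)"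
      using bound[of "sqrt (\<nu> / (C * t))"] 3 C pos unfolding V by simp
    then show ?thesis
      using 3 pos by (simp add: gaussian_growth_bound_def self_power_def ennreal_mult[symmetric] heat_kernel_nonneg mult_ac)
  next
    case 4
    define y where "y = C * (t * u\<^sup>2 / \<nu>)"
    have y: "0 < y"
      using 4 C pos by (simp add: y_def)
    have z: "ennreal C * (ennreal t * U\<^sup>2 / ennreal \<nu>) = ennreal y"
      using 4 C pos by (simp add: y_def ennreal_power ennreal_mult[symmetric] divide_ennreal)
    have "ennreal (6 * \<kappa> * exp y * ?H x) \<le> gaussian_growth_bound (6 * exp 1) C \<delta> \<nu> \<kappa> \<sigma> t U x" for x :: 'a
    proof -
      have "ennreal (6 * \<kappa> * exp y * ?H x) = ennreal (6 * \<kappa>) * ennreal (exp y) * ennreal (?H x)"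
        using pos by (simp add: ennreal_mult heat_kernel_nonneg)
      also have "\<dots> \<le> ennreal (6 * \<kappa>) * (ennreal (exp 1) * self_power (ennreal y)) * ennreal (?H x)"
        by (intro mult_left_mono mult_right_mono exp_le_self_power y) auto
      also have "\<dots> = gaussian_growth_bound (6 * exp 1) C \<delta> \<nu> \<kappa> \<sigma> t U x"
        using pos by (simp add: gaussian_growth_bound_def z ennreal_mult mult_ac)
      finally show ?thesis .
    qed
    moreover have "AE x in lborel. ennreal (norm (w t x)) \<le> ennreal (6 * \<kappa> * exp y * ?H x)"
      using bound[of u] 4 by (simp add: y_def)
    ultimately show ?thesis
      by (auto elim!: eventually_mono intro: order_trans)
  qed
  then show ?thesis
    by (simp add: U_def C_def)
qed

text \<open>An element of L^p has no values at single points. The bound "for all x" is therefore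
  split: off a null set for any representative, and exactly wherever the chosen one is
  continuous.\<close>

lemma gaussian_growth_bound_ae_and_isCont:
  fixes w :: "real \<Rightarrow> 'a::euclidean_space \<Rightarrow> 'v::euclidean_space"
  assumes sol: "maximal_strong_solution K \<Phi> \<nu> w0 w"
    and t: "0 \<le> t" "ereal t < max_lifespan K \<Phi> \<nu> w0"
    and dim: "DIM('a) \<le> 3"
    and \<Phi>: "\<And>u v l. l \<in> Basis \<Longrightarrow> norm (\<Phi> u v l) \<le> 2 * norm u * norm v"
    and w0: "AE x in lborel. norm (w0 x) \<le> \<kappa> * heat_kernel (\<nu> * \<sigma>) x"
    and pos: "0 < \<nu>" "0 < \<kappa>" "0 < \<sigma>"
    and \<delta>: "0 < \<delta>" "\<delta> \<le> 1"
  defines "B \<equiv> gaussian_growth_bound (6 * exp 1) (2592 * pi / \<delta>) \<delta> \<nu> \<kappa> \<sigma> t (sup_norm_upto t (\<lambda>s. velocity K (w s)))"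
  shows "(AE x in lborel. ennreal (norm (w t x)) \<le> B x) \<and> (\<forall>x. isCont (w t) x \<longrightarrow> ennreal (norm (w t x)) \<le> B x)"
proof (intro conjI allI impI)
  show AE: "AE x in lborel. ennreal (norm (w t x)) \<le> B x"
    unfolding B_def using assms by (intro maximal_strong_solution_gaussian_growth_bound[OF sol]) auto
  fix x assume "isCont (w t) x"
  then have "isCont (\<lambda>x. ennreal (norm (w t x))) x"
    unfolding isCont_def by (intro tendsto_ennrealI tendsto_norm)
  moreover have "isCont B x"
    unfolding B_def using t pos \<delta> by (intro isCont_gaussian_growth_bound) auto
  ultimately show "ennreal (norm (w t x)) \<le> B x"
    by (rule AE_le_imp_le_isCont[OF AE])
qed

section \<open>Flux bounds and the two concrete equations\<close>

lemma norm_flux2_le: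
  assumes "l \<in> Basis"
  shows "norm (flux2 u v l) \<le> 2 * norm u * norm v"
proof -
  have "\<bar>u \<bullet> l\<bar> * \<bar>v\<bar> \<le> norm u * \<bar>v\<bar>"
    using Basis_le_norm[OF assms, of u] by (intro mult_right_mono) auto
  also have "\<dots> \<le> 2 * norm u * norm v"
    by (simp add: mult_right_mono)
  finally show ?thesis
    by (simp add: flux2_def abs_mult)
qed

text \<open>Transport and stretching contribute |u| |v| each, whence the 2 in the common flux
  bound.\<close>

lemma norm_flux3_le:
  assumes "l \<in> Basis"
  shows "norm (flux3 u v l) \<le> 2 * norm u * norm v"
proof -
  have "norm (flux3 u v l) \<le> norm (- (u \<bullet> l) *\<^sub>R v) + norm ((v \<bullet> l) *\<^sub>R u)"
    unfolding flux3_def by (rule norm_triangle_ineq)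
  also have "\<dots> \<le> norm u * norm v + norm v * norm u"
    unfolding norm_scaleR abs_minus real_norm_def abs_minus_cancel
    using Basis_le_norm[OF assms] by (intro add_mono mult_right_mono) auto
  finally show ?thesis
    by simp
qed

theorem theorem1p1:
  "\<exists>A::real. 0 < A \<and> (\<forall>\<delta>::real. 0 < \<delta> \<and> \<delta> \<le> 1 \<longrightarrow> (\<exists>C::real. 0 < C \<and>
    (\<forall>(\<nu>::real) (\<kappa>::real) (\<sigma>::real) (w0 :: real^2 \<Rightarrow> real) (w :: real \<Rightarrow> real^2 \<Rightarrow> real).
      0 < \<nu> \<and> 0 < \<kappa> \<and> 0 < \<sigma> \<and>
      w0 \<in> Lp_space \<infinity> lborel \<and>
      (AE x in lborel. \<bar>w0 x\<bar> \<le> \<kappa> * heat_kernel (\<nu> * \<sigma>) x) \<and>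
      maximal_strong_solution biot_savart2 flux2 \<nu> w0 w \<longrightarrow>
      (\<forall>t. 0 \<le> t \<and> ereal t < max_lifespan biot_savart2 flux2 \<nu> w0 \<longrightarrow>
        (let U = sup_norm_upto t (\<lambda>s. velocity biot_savart2 (w s));
             bounded_at = (\<lambda>x. ennreal \<bar>w t x\<bar> \<le> gaussian_growth_bound A C \<delta> \<nu> \<kappa> \<sigma> t U x)
         in (AE x in lborel. bounded_at x) \<and> (\<forall>x. isCont (w t) x \<longrightarrow> bounded_at x)))) \<and>
    (\<forall>(\<nu>::real) (\<kappa>::real) (\<sigma>::real) (w0 :: real^3 \<Rightarrow> real^3) (w :: real \<Rightarrow> real^3 \<Rightarrow> real^3).
      0 < \<nu> \<and> 0 < \<kappa> \<and> 0 < \<sigma> \<and>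
      w0 \<in> Lp_space \<infinity> lborel \<and>
      (AE x in lborel. norm (w0 x) \<le> \<kappa> * heat_kernel (\<nu> * \<sigma>) x) \<and>
      maximal_strong_solution biot_savart3 flux3 \<nu> w0 w \<longrightarrow>
      (\<forall>t. 0 \<le> t \<and> ereal t < max_lifespan biot_savart3 flux3 \<nu> w0 \<longrightarrow>
        (let U = sup_norm_upto t (\<lambda>s. velocity biot_savart3 (w s));
             bounded_at = (\<lambda>x. ennreal (norm (w t x)) \<le> gaussian_growth_bound A C \<delta> \<nu> \<kappa> \<sigma> t U x)
         in (AE x in lborel. bounded_at x) \<and> (\<forall>x. isCont (w t) x \<longrightarrow> bounded_at x))))))"
\<comment> \<open>A = 6 e: the 3 from widening the Gaussian, doubled because K g \<le> g / 2, times
  the e lost in passing to the self power.\<close>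
proof (rule exI[of _ "6 * exp 1"], intro conjI allI impI, goal_cases)
  case 1
  show ?case
    by simp
next
  case (2 \<delta>)
  show ?case
  \<comment> \<open>The growth rate 4 pi c^2 with c^2 = 648 V^2 / (\<delta> \<nu>), stripped of V^2
    / \<nu>.\<close>
  proof (rule exI[of _ "2592 * pi / \<delta>"], intro conjI allI impI, goal_cases)
    case 1
    show ?case
      using 2 by simp
  next
    case (2 \<nu> \<kappa> \<sigma> w0 w t)
    have "(AE x in lborel. ennreal (norm (w t x)) \<le> gaussian_growth_bound (6 * exp 1) (2592 * pi / \<delta>) \<delta> \<nu> \<kappa> \<sigma> t
        (sup_norm_upto t (\<lambda>s. velocity biot_savart2 (w s))) x) \<and>
      (\<forall>x. isCont (w t) x \<longrightarrow> ennreal (norm (w t x)) \<le> gaussian_growth_bound (6 * exp 1) (2592 * pi / \<delta>) \<delta> \<nu> \<kappa> \<sigma> t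
        (sup_norm_upto t (\<lambda>s. velocity biot_savart2 (w s))) x)"
      using 2 \<open>0 < \<delta> \<and> \<delta> \<le> 1\<close>
      by (intro gaussian_growth_bound_ae_and_isCont[where \<Phi> = flux2] norm_flux2_le) auto
    then show ?case
      by (simp add: Let_def)
  next
    case (3 \<nu> \<kappa> \<sigma> w0 w t)
    have "(AE x in lborel. ennreal (norm (w t x)) \<le> gaussian_growth_bound (6 * exp 1) (2592 * pi / \<delta>) \<delta> \<nu> \<kappa> \<sigma> t
        (sup_norm_upto t (\<lambda>s. velocity biot_savart3 (w s))) x) \<and>
      (\<forall>x. isCont (w t) x \<longrightarrow> ennreal (norm (w t x)) \<le> gaussian_growth_bound (6 * exp 1) (2592 * pi / \<delta>) \<delta> \<nu> \<kappa> \<sigma> t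
        (sup_norm_upto t (\<lambda>s. velocity biot_savart3 (w s))) x)"
      using 3 \<open>0 < \<delta> \<and> \<delta> \<le> 1\<close>
      by (intro gaussian_growth_bound_ae_and_isCont[where \<Phi> = flux3] norm_flux3_le) auto
    then show ?case
      by (simp add: Let_def)
  qed
qed

end
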